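(* Let $\mathcal{C}$ be the class of subshifts $(X,T)$ which have non-uniform specification with gap bounds $f(n)$ (at scale an expansivity constant of $(X,T)$) for some $f$ satisfying $\liminf_{n\to\infty} f(n)/\ln n = 0$. Then: (1) $\mathcal{C}$ is closed under subshift factors: if $(X,T)\in\mathcal{C}$, $(Y,S)$ is a subshift, and there is a continuous surjection $\pi:X\to Y$ with $\pi\circ T=S\circ\pi$, then $(Y,S)\in\mathcal{C}$. (2) For every $(X,T)\in\mathcal{C}$, every H\"older potential $\phi:X\to\mathbb{R}$ is hyperbolic.
   Context: A subshift $(X,T)$ is a closed shift-invariant set $X\subset A^{\mathbb{Z}}$, where $A$ is a finite alphabet, with $T$ the left shift $(Tx)(i)=x(i+1)$. It carries the usual metric $d(x,y)=2^{-\min\{|n|:x(n)\ne y(n)\}}$ for $x\neq y$; the H\"older property is with respect to this metric. An expansivity constant is a $\delta>0$ such that for all $x\ne y$ in $X$ there is $n\in\mathbb{Z}$ with $d(T^nx,T^ny)>\delta$ (e.g. any $\delta \in (0,1)$). Shadowing: $z\in X$ $\eta$-shadows $(x_1,\dots,x_k)$ for $(n_1,\dots,n_k)$ iterates with gaps $(m_1,\dots,m_{k-1})$ if $d(T^{m+\sum_{j=1}^{i-1}(n_j+m_j)}z,T^mx_i)<\eta$ for every $1\le i\le k$ and $0\le m<n_i$. Non-uniform specification: for an increasing (i.e. nondecreasing) function $f:\mathbb{N}\to\mathbb{N}$ (values may be $0$), $(X,T)$ has non-uniform specification with gap bounds $f(n)$ at scale $\eta$ if for any $k\ge 1$, any $x_1,\dots,x_k\in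 X$, any positive integers $n_1,\dots,n_k$ and any integers $m_1,\dots,m_{k-1}$ with $m_i\ge\max(f(n_i),f(n_{i+1}))$, there is $z\in X$ which $\eta$-shadows $(x_i)$ for $(n_i)$ iterates with gaps $(m_i)$. A potential on $(X,T)$ is a continuous function $\phi:X\to\mathbb{R}$. An equilibrium state for $\phi$ is a $T$-invariant Borel probability measure $\mu$ on $X$ attaining $\sup_\nu\left(h(X,T,\nu)+\int\phi\,d\nu\right)$, the supremum being over all $T$-invariant Borel probability measures $\nu$ on $X$, where $h$ is measure-theoretic entropy. A potential $\phi$ on $(X,T)$ is hyperbolic if every equilibrium state $\mu$ for $\phi$ has $h(X,T,\mu)>0$.
   Formalization: In part (2) the subshift X is assumed not to consist of a single point; for a one-point subshift the claim is false, since the point mass is the equilibrium state of every potential and has entropy zero. *)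

theory Defs
  imports "HOL-Probability.Probability"
begin

text \<open>
  The alphabet is a finite type with its discrete topology, so the type \<open>int \<Rightarrow> 'a\<close> is the full
  shift, and its topology is the product topology (the function-type instance of
  \<open>HOL-Analysis.Function_Topology\<close>).
\<close>

definition shift :: "(int \<Rightarrow> 'a) \<Rightarrow> int \<Rightarrow> 'a" where
  "shift x = (\<lambda>i. x (i + 1))"

text \<open>All integer powers of the shift; expansivity is two-sided.\<close>

definition shift_pow :: "int \<Rightarrow> (int \<Rightarrow> 'a) \<Rightarrow> int \<Rightarrow> 'a" where
  "shift_pow k x = (\<lambda>i. x (i + k))"

lemma funpow_shift_eq_shift_pow: "(shift ^^ n) x = shift_pow (int n) x"
  by (induction n) (simp_all add: shift_def shift_pow_def algebra_simps)

definition subshift :: "(int \<Rightarrow> 'a::{finite,discrete_topology}) set \<Rightarrow> bool" where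
  "subshift X \<longleftrightarrow> closed X \<and> shift ` X = X"

definition shift_dist :: "(int \<Rightarrow> 'a) \<Rightarrow> (int \<Rightarrow> 'a) \<Rightarrow> real" where
  "shift_dist x y =
     (if x = y then 0 else (1/2) ^ (LEAST k. \<exists>n::int. k = nat \<bar>n\<bar> \<and> x n \<noteq> y n))"

definition expansivity_constant :: "(int \<Rightarrow> 'a) set \<Rightarrow> real \<Rightarrow> bool" where
  "expansivity_constant X \<delta> \<longleftrightarrow>
     \<delta> > 0 \<and>
     (\<forall>x\<in>X. \<forall>y\<in>X. x \<noteq> y \<longrightarrow> (\<exists>n::int. shift_dist (shift_pow n x) (shift_pow n y) > \<delta>))"

text \<open>
  The tuples \<open>(x\<^sub>1,\<dots>,x\<^sub>k)\<close>, \<open>(n\<^sub>1,\<dots>,n\<^sub>k)\<close> and \<open>(m\<^sub>1,\<dots>,m\<^bsub>k-1\<^esub>)\<close> are functions on the naturals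
  of which only the values at \<open>1,\<dots>,k\<close> (respectively \<open>1,\<dots>,k-1\<close>) are used. The gaps
  are nonnegative integers, since they are bounded below by values of \<open>f\<close>.
\<close>

definition shadows ::
    "real \<Rightarrow> nat \<Rightarrow> (nat \<Rightarrow> int \<Rightarrow> 'a) \<Rightarrow> (nat \<Rightarrow> nat) \<Rightarrow> (nat \<Rightarrow> nat) \<Rightarrow> (int \<Rightarrow> 'a) \<Rightarrow> bool" where
  "shadows \<eta> k xs ns ms z \<longleftrightarrow>
     (\<forall>i\<in>{1..k}. \<forall>m<ns i.
        shift_dist ((shift ^^ (m + (\<Sum>j=1..<i. ns j + ms j))) z) ((shift ^^ m) (xs i)) < \<eta>)"

definition nonuniform_specification ::
    "(int \<Rightarrow> 'a) set \<Rightarrow> (nat \<Rightarrow> nat) \<Rightarrow> real \<Rightarrow> bool" where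
  "nonuniform_specification X f \<eta> \<longleftrightarrow>
     (\<forall>k\<ge>1. \<forall>xs ns ms.
        (\<forall>i\<in>{1..k}. xs i \<in> X) \<and> (\<forall>i\<in>{1..k}. ns i > 0) \<and>
        (\<forall>i\<in>{1..<k}. ms i \<ge> max (f (ns i)) (f (ns (i + 1)))) \<longrightarrow>
        (\<exists>z\<in>X. shadows \<eta> k xs ns ms z))"

definition spec_class :: "(int \<Rightarrow> 'a::{finite,discrete_topology}) set set" where
  "spec_class =
     {X. subshift X \<and>
         (\<exists>f \<delta>. mono f \<and> expansivity_constant X \<delta> \<and> nonuniform_specification X f \<delta> \<and>
                liminf (\<lambda>n. ereal (real (f n) / ln (real n))) = 0)}"

definition subshift_factor_map ::
    "(int \<Rightarrow> 'a::{finite,discrete_topology}) set \<Rightarrow> (int \<Rightarrow> 'b::{finite,discrete_topology}) set \<Rightarrow>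
     ((int \<Rightarrow> 'a) \<Rightarrow> (int \<Rightarrow> 'b)) \<Rightarrow> bool" where
  "subshift_factor_map X Y \<pi> \<longleftrightarrow>
     continuous_on X \<pi> \<and> \<pi> ` X = Y \<and> (\<forall>x\<in>X. \<pi> (shift x) = shift (\<pi> x))"

text \<open>Kolmogorov--Sinai entropy with natural logarithms; note \<open>ln 0 = 0\<close>.\<close>

definition partition_entropy :: "'b measure \<Rightarrow> 'b set set \<Rightarrow> real" where
  "partition_entropy \<mu> P = - (\<Sum>A\<in>P. measure \<mu> A * ln (measure \<mu> A))"

text \<open>The join of the preimages of \<open>P\<close> under \<open>T\<^sup>i\<close> for \<open>i < n\<close>.\<close>

definition iterated_join :: "'b measure \<Rightarrow> ('b \<Rightarrow> 'b) \<Rightarrow> 'b set set \<Rightarrow> nat \<Rightarrow> 'b set set" where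
  "iterated_join \<mu> T P n =
     {{x \<in> space \<mu>. \<forall>i<n. (T ^^ i) x \<in> a i} | a. \<forall>i<n. a i \<in> P} - {{}}"

definition entropy_wrt_partition :: "'b measure \<Rightarrow> ('b \<Rightarrow> 'b) \<Rightarrow> 'b set set \<Rightarrow> real" where
  "entropy_wrt_partition \<mu> T P =
     lim (\<lambda>n. partition_entropy \<mu> (iterated_join \<mu> T P n) / real n)"

definition ks_entropy :: "'b measure \<Rightarrow> ('b \<Rightarrow> 'b) \<Rightarrow> ereal" where
  "ks_entropy \<mu> T =
     (SUP P\<in>{P. finite P \<and> P \<subseteq> sets \<mu> \<and> partition_on (space \<mu>) P}.
        ereal (entropy_wrt_partition \<mu> T P))"

definition invariant_measures ::
    "(int \<Rightarrow> 'a::{finite,discrete_topology}) set \<Rightarrow> (int \<Rightarrow> 'a) measure set" where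
  "invariant_measures X =
     {\<mu>. prob_space \<mu> \<and> sets \<mu> = sets (restrict_space borel X) \<and> distr \<mu> \<mu> shift = \<mu>}"

definition free_energy :: "((int \<Rightarrow> 'a) \<Rightarrow> real) \<Rightarrow> (int \<Rightarrow> 'a) measure \<Rightarrow> ereal" where
  "free_energy \<phi> \<mu> = ks_entropy \<mu> shift + ereal (integral\<^sup>L \<mu> \<phi>)"

text \<open>
  A potential on \<open>X\<close> is a function on the full shift of which only the restriction to \<open>X\<close> matters.
\<close>

definition potential ::
    "(int \<Rightarrow> 'a::{finite,discrete_topology}) set \<Rightarrow> ((int \<Rightarrow> 'a) \<Rightarrow> real) \<Rightarrow> bool" where
  "potential X \<phi> \<longleftrightarrow> continuous_on X \<phi>"

definition equilibrium_state ::
    "(int \<Rightarrow> 'a::{finite,discrete_topology}) set \<Rightarrow> ((int \<Rightarrow> 'a) \<Rightarrow> real) \<Rightarrow>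
     (int \<Rightarrow> 'a) measure \<Rightarrow> bool" where
  "equilibrium_state X \<phi> \<mu> \<longleftrightarrow>
     \<mu> \<in> invariant_measures X \<and>
     free_energy \<phi> \<mu> = (SUP \<nu>\<in>invariant_measures X. free_energy \<phi> \<nu>)"

definition hyperbolic ::
    "(int \<Rightarrow> 'a::{finite,discrete_topology}) set \<Rightarrow> ((int \<Rightarrow> 'a) \<Rightarrow> real) \<Rightarrow> bool" where
  "hyperbolic X \<phi> \<longleftrightarrow> (\<forall>\<mu>. equilibrium_state X \<phi> \<mu> \<longrightarrow> ks_entropy \<mu> shift > 0)"

definition holder_on :: "(int \<Rightarrow> 'a) set \<Rightarrow> ((int \<Rightarrow> 'a) \<Rightarrow> real) \<Rightarrow> bool" where
  "holder_on X \<phi> \<longleftrightarrow>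
     (\<exists>C \<alpha>. \<alpha> > 0 \<and> (\<forall>x\<in>X. \<forall>y\<in>X. \<bar>\<phi> x - \<phi> y\<bar> \<le> C * shift_dist x y powr \<alpha>))"

end

theory Submission
  imports Defs "HOL-Real_Asymp.Real_Asymp"
begin

text \<open>
  The class is closed under factors because a continuous map between subshifts that commutes with
  the shift is a sliding block code (\<open>block_code\<close>). A word of the factor is the image of a word that
  is longer by twice the radius of the code, so constants are added to the gap function and to its
  argument (\<open>spec_class_factor\<close>), and \<open>liminf f n / ln n = 0\<close> is not affected.

  For hyperbolicity, let \<open>\<mu>\<close> be an equilibrium state of entropy zero and \<open>\<beta>\<close> its integral. No invariant
  measure has free energy above \<open>\<beta>\<close>. This is contradicted by a measure that arises from cutting and
  gluing orbits. For every \<open>M\<close> some point \<open>x\<close> has a Birkhoff sum of length \<open>M\<close> of at least \<open>M * \<beta>\<close>. Cutting its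
  orbit segment at one place and gluing the pieces costs only a multiple of the gap \<open>f M + 1\<close>, by
  bounded distortion (\<open>holder_distortion\<close>). The freedom to choose the place among \<open>R\<close> possibilities
  gives the entropy \<open>ln R\<close> in \<open>M\<close> units of time. With \<open>R\<close> about \<open>M powr (1/4)\<close> the gain is a fixed
  multiple of \<open>ln M\<close>, whereas \<open>f M\<close> is an arbitrarily small multiple of \<open>ln M\<close> for arbitrarily large
  \<open>M\<close>; so the gain exceeds the cost.

  The delicate point is that different places must give different words, although nothing is known
  about \<open>x\<close>; a marker alone would not do, since it may occur in \<open>x\<close> many times. If \<open>x\<close> is nowhere constant
  for long, the second piece is glued back with a delay of one symbol, and the place of the cut can be
  recovered because a word that coincides with its own delay is constant. If \<open>x\<close> is constant on a long
  stretch, the cuts are made there, and a single different symbol marks them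
  (\<open>free_energy_of_long_orbit\<close>).

  Free concatenation of such pieces gives sets of points with exponentially many words
  (\<open>free_energy_of_patterns\<close>), and these have to be turned into an invariant measure
  (\<open>variational_lower_bound\<close>). The measure is a limit of empirical measures on cylinder sets,
  extended by compactness (\<open>orbit_average_limit\<close>). Its entropy is bounded from below by comparing the
  number of words with the weights that a Markov kernel gives them (\<open>ln_card_le_orbit_average\<close>):
  for the kernel of conditional probabilities of the limit measure, the growth rate of the number of
  words is at most each increment of the block entropy (\<open>block_entropy_increment_ge\<close>). The increments
  decrease, because block entropy is concave in the length (\<open>block_entropy_concave\<close>), so they bound
  the entropy of the measure itself.
\<close>

section \<open>Cylinder sets of a subshift\<close>

definition agree :: "nat \<Rightarrow> (int \<Rightarrow> 'a) \<Rightarrow> (int \<Rightarrow> 'a) \<Rightarrow> bool" where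
  "agree N x y \<longleftrightarrow> (\<forall>i. \<bar>i\<bar> \<le> int N \<longrightarrow> x i = y i)"

text \<open>
  These are the finite unions of cylinders over the coordinates \<open>-N, \<dots>, N\<close>. Describing them by
  closure under agreement on the window makes Boolean operations immediate and avoids choosing
  a finite set of words for each of them.
\<close>

definition saturated :: "(int \<Rightarrow> 'a) set \<Rightarrow> nat \<Rightarrow> (int \<Rightarrow> 'a) set \<Rightarrow> bool" where
  "saturated X N C \<longleftrightarrow> C \<subseteq> X \<and> (\<forall>x\<in>C. \<forall>y\<in>X. agree N x y \<longrightarrow> y \<in> C)"

definition cylinder_algebra :: "(int \<Rightarrow> 'a) set \<Rightarrow> (int \<Rightarrow> 'a) set set" where
  "cylinder_algebra X = {C. \<exists>N. saturated X N C}"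

lemma agree_refl [simp]: "agree N x x"
  by (simp add: agree_def)

lemma agree_sym: "agree N x y \<Longrightarrow> agree N y x"
  by (simp add: agree_def)

lemma agree_trans: "agree N x y \<Longrightarrow> agree N y z \<Longrightarrow> agree N x z"
  by (simp add: agree_def)

lemma agree_mono: "M \<le> N \<Longrightarrow> agree N x y \<Longrightarrow> agree M x y"
  by (auto simp: agree_def)

lemma saturated_mono: "M \<le> N \<Longrightarrow> saturated X M C \<Longrightarrow> saturated X N C"
  unfolding saturated_def by (meson agree_mono)

lemma saturated_Un: "saturated X N C \<Longrightarrow> saturated X N D \<Longrightarrow> saturated X N (C \<union> D)"
  unfolding saturated_def by blast

lemma saturated_Diff: "saturated X N C \<Longrightarrow> saturated X N D \<Longrightarrow> saturated X N (C - D)"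
  unfolding saturated_def by (meson Diff_iff agree_sym subset_iff)

lemma saturated_space: "saturated X N X"
  by (auto simp: saturated_def)

lemma saturated_empty: "saturated X N {}"
  by (auto simp: saturated_def)

lemma cylinder_algebraI: "saturated X N C \<Longrightarrow> C \<in> cylinder_algebra X"
  by (auto simp: cylinder_algebra_def)

lemma cylinder_algebra_two:
  assumes "C \<in> cylinder_algebra X" "D \<in> cylinder_algebra X"
  obtains N where "saturated X N C" "saturated X N D"
proof -
  from assms obtain M N where "saturated X M C" "saturated X N D"
    by (auto simp: cylinder_algebra_def)
  then have "saturated X (max M N) C" "saturated X (max M N) D"
    by (auto intro: saturated_mono[rotated])
  then show ?thesis by (rule that)
qed

lemma algebra_cylinder_algebra: "algebra X (cylinder_algebra X)"
  unfolding algebra_iff_Un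
proof (intro conjI ballI)
  show "cylinder_algebra X \<subseteq> Pow X"
    by (auto simp: cylinder_algebra_def saturated_def)
  show "{} \<in> cylinder_algebra X"
    using saturated_empty by (rule cylinder_algebraI)
  show "X - C \<in> cylinder_algebra X" if "C \<in> cylinder_algebra X" for C
    using that saturated_Diff[OF saturated_space]
    by (auto simp: cylinder_algebra_def)
  show "C \<union> D \<in> cylinder_algebra X"
    if "C \<in> cylinder_algebra X" "D \<in> cylinder_algebra X" for C D
    by (rule cylinder_algebra_two[OF that]) (blast intro: saturated_Un cylinder_algebraI)
qed

text \<open>
  A saturated set is determined by the restrictions of its points to the window.
\<close>

lemma finite_saturated: "finite {C. saturated (X :: (int \<Rightarrow> 'a::finite) set) N C}"
proof -
  define r where "r x = (\<lambda>i\<in>{- int N..int N}. x i)" for x :: "int \<Rightarrow> 'a"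
  have r: "r x = r y \<longleftrightarrow> agree N x y" for x y
  proof
    assume "r x = r y"
    then have "r x i = r y i" for i by simp
    then have "x i = y i" if "i \<in> {- int N..int N}" for i
      using that unfolding r_def by (metis restrict_apply')
    then show "agree N x y" by (auto simp: agree_def abs_le_iff)
  next
    assume "agree N x y"
    then show "r x = r y"
      unfolding r_def by (intro restrict_ext) (auto simp: agree_def abs_le_iff)
  qed
  have "{C. saturated X N C} \<subseteq>
          (\<lambda>S. {x\<in>X. r x \<in> S}) ` Pow (PiE {- int N..int N} (\<lambda>_. UNIV))"
  proof
    fix C assume "C \<in> {C. saturated X N C}"
    then have C: "C \<subseteq> X" "\<And>x y. x \<in> C \<Longrightarrow> y \<in> X \<Longrightarrow> agree N x y \<Longrightarrow> y \<in> C"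
      by (auto simp: saturated_def)
    have "C = {x\<in>X. r x \<in> r ` C}"
    proof
      show "{x\<in>X. r x \<in> r ` C} \<subseteq> C"
      proof clarify
        fix x y assume "x \<in> X" "r x = r y" "y \<in> C"
        then show "x \<in> C" using C(2)[of y x] r[of y x] by simp
      qed
    qed (use C(1) in blast)
    moreover have "r ` C \<subseteq> PiE {- int N..int N} (\<lambda>_. UNIV)"
      by (auto simp: r_def)
    ultimately show "C \<in> (\<lambda>S. {x\<in>X. r x \<in> S}) ` Pow (PiE {- int N..int N} (\<lambda>_. UNIV))"
      by blast
  qed
  then show ?thesis
    by (rule finite_subset) (simp add: finite_PiE)
qed

lemma countable_cylinder_algebra:
  "countable (cylinder_algebra (X :: (int \<Rightarrow> 'a::finite) set))"
proof -
  have "cylinder_algebra X = (\<Union>N. {C. saturated X N C})"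
    by (auto simp: cylinder_algebra_def)
  then show ?thesis
    by (simp add: finite_saturated countable_finite)
qed

lemma open_agree:
  fixes x :: "int \<Rightarrow> 'a::discrete_topology"
  shows "open {y. agree N x y}"
proof -
  have "open {y. \<forall>i\<in>{- int N..int N}. y i \<in> {x i}}"
    by (rule product_topology_basis'[where x = "\<lambda>i. i"]) (simp_all add: Topological_Spaces.open_discrete)
  moreover have "(\<forall>i\<in>{- int N..int N}. y i \<in> {x i}) \<longleftrightarrow> agree N x y" for y
    unfolding agree_def Ball_def atLeastAtMost_iff abs_le_iff
    using minus_le_iff[of "int N"] by auto
  ultimately show ?thesis by simp
qed

lemma open_contains_agree:
  fixes x :: "int \<Rightarrow> 'a::discrete_topology"
  assumes "open U" "x \<in> U"
  obtains N where "{y. agree N x y} \<subseteq> U"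
proof -
  have "openin (product_topology (\<lambda>_. euclidean) UNIV) U"
    using assms(1) by (simp only: open_fun_def)
  from product_topology_open_contains_basis[OF this assms(2)]
  obtain V where V: "x \<in> PiE UNIV V" "finite {i. V i \<noteq> UNIV}" "PiE UNIV V \<subseteq> U"
    unfolding topspace_euclidean by (elim exE conjE)
  define N where "N = Max (insert 0 ((\<lambda>i. nat \<bar>i\<bar>) ` {i. V i \<noteq> UNIV}))"
  have N: "\<bar>i\<bar> \<le> int N" if "V i \<noteq> UNIV" for i
  proof -
    have "nat \<bar>i\<bar> \<le> N"
      unfolding N_def
    proof (rule Max_ge)
      show "finite (insert 0 ((\<lambda>i. nat \<bar>i\<bar>) ` {i. V i \<noteq> UNIV}))"
        using V(2) by (intro finite.insertI finite_imageI)
      show "nat \<bar>i\<bar> \<in> insert 0 ((\<lambda>i. nat \<bar>i\<bar>) ` {i. V i \<noteq> UNIV})"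
        using that by blast
    qed
    then show ?thesis by linarith
  qed
  have "y \<in> PiE UNIV V" if "agree N x y" for y
  proof (rule PiE_I)
    fix i show "y i \<in> V i"
    proof (cases "V i = UNIV")
      case False
      then have "y i = x i"
        using that N by (simp add: agree_def)
      then show ?thesis using V(1) by (metis PiE_mem UNIV_I)
    qed simp
  qed simp
  with V(3) have "{y. agree N x y} \<subseteq> U" by (simp add: subset_iff)
  then show ?thesis by (rule that)
qed

lemma cylinder_algebra_open:
  fixes X :: "(int \<Rightarrow> 'a::discrete_topology) set"
  assumes "C \<in> cylinder_algebra X"
  obtains U where "open U" "C = X \<inter> U"
proof -
  from assms obtain N where N: "saturated X N C" by (auto simp: cylinder_algebra_def)
  show ?thesis
  proof
    show "open (\<Union>x\<in>C. {y. agree N x y})" by (intro open_UN ballI open_agree)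
    show "C = X \<inter> (\<Union>x\<in>C. {y. agree N x y})"
    proof
      show "C \<subseteq> X \<inter> (\<Union>x\<in>C. {y. agree N x y})"
      proof
        fix x assume "x \<in> C"
        then show "x \<in> X \<inter> (\<Union>x\<in>C. {y. agree N x y})"
          using N agree_refl[of N x] unfolding saturated_def by blast
      qed
      show "X \<inter> (\<Union>x\<in>C. {y. agree N x y}) \<subseteq> C"
        using N unfolding saturated_def by blast
    qed
  qed
qed

lemma cylinder_algebra_closed:
  fixes X :: "(int \<Rightarrow> 'a::discrete_topology) set"
  assumes "C \<in> cylinder_algebra X" "closed X"
  shows "closed C"
proof -
  have "X - C \<in> cylinder_algebra X"
    using assms(1) algebra_cylinder_algebra[of X] by (simp add: algebra_iff_Un)
  then obtain U where U: "open U" "X - C = X \<inter> U"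
    by (rule cylinder_algebra_open)
  have "C \<subseteq> X" using assms(1) by (auto simp: cylinder_algebra_def saturated_def)
  then have "C = X - U" using U(2) by blast
  then show ?thesis using U(1) assms(2) by (simp add: closed_Diff)
qed

lemma compact_full_shift: "compact (UNIV :: (int \<Rightarrow> 'a::{finite,discrete_topology}) set)"
proof -
  have "compactin (product_topology (\<lambda>_::int. euclidean :: 'a topology) UNIV) (PiE UNIV (\<lambda>_. UNIV))"
    unfolding compactin_PiE by (simp add: finite_imp_compact)
  then show ?thesis by (simp add: euclidean_product_topology)
qed

text \<open>
  This form of compactness serves twice: it makes a finitely additive function on cylinder sets
  automatically countably additive, and it makes a continuous map between subshifts a
  sliding block code.
\<close>

lemma decseq_cylinder_empty:
  fixes X :: "(int \<Rightarrow> 'a::{finite,discrete_topology}) set"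
  assumes "closed X" "range A \<subseteq> cylinder_algebra X" "decseq A" "(\<Inter>i. A i) = {}"
  obtains i where "A i = {}"
proof -
  have "\<exists>i. A i = {}"
  proof (rule ccontr)
    assume ne: "\<nexists>i. A i = {}"
    have "closed (A i)" for i
      by (rule cylinder_algebra_closed[OF subsetD[OF assms(2) rangeI] assms(1)])
    have "UNIV \<inter> \<Inter>(range A) \<noteq> {}"
    proof (rule compact_imp_fip[OF compact_full_shift])
      show "closed T" if "T \<in> range A" for T
        using that \<open>\<And>i. closed (A i)\<close> by blast
      fix F assume "finite F" "F \<subseteq> range A"
      then obtain I where I: "finite I" "F = A ` I"
        by (meson finite_subset_image)
      define i where "i = Max (insert 0 I)"
      have "A i \<subseteq> A j" if "j \<in> I" for j
      proof (rule decseqD[OF assms(3)])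
        show "j \<le> i" using I(1) that by (simp add: i_def)
      qed
      then have "A i \<subseteq> \<Inter>F" unfolding I(2) by blast
      then show "UNIV \<inter> \<Inter>F \<noteq> {}" using ne by blast
    qed
    then show False using assms(4) by simp
  qed
  then show ?thesis using that by blast
qed

text \<open>
  Every open set is the union of the cylinder sets that it contains, and there are only countably
  many cylinder sets.
\<close>

lemma sigma_sets_cylinder_algebra:
  fixes X :: "(int \<Rightarrow> 'a::{finite,discrete_topology}) set"
  shows "sets (restrict_space borel X) = sigma_sets X (cylinder_algebra X)"
proof (rule antisym)
  have basic: "X \<inter> U \<in> sigma_sets X (cylinder_algebra X)" if "open U" for U
  proof -
    define \<C> where "\<C> = {C\<in>cylinder_algebra X. C \<subseteq> U}"
    have "countable \<C>"
      unfolding \<C>_def using countable_cylinder_algebra[of X] by (rule countable_subset[rotated]) auto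
    moreover have "X \<inter> U = \<Union>\<C>"
    proof
      show "X \<inter> U \<subseteq> \<Union>\<C>"
      proof
        fix x assume x: "x \<in> X \<inter> U"
        then obtain N where N: "{y. agree N x y} \<subseteq> U"
          using open_contains_agree[OF \<open>open U\<close>] by blast
        have "saturated X N {y\<in>X. agree N x y}"
          by (auto simp: saturated_def intro: agree_trans)
        with N have "{y\<in>X. agree N x y} \<in> \<C>"
          unfolding \<C>_def by (auto simp: cylinder_algebra_def)
        then show "x \<in> \<Union>\<C>" by (rule UnionI) (use x in simp)
      qed
    qed (auto simp: \<C>_def cylinder_algebra_def saturated_def)
    moreover have "\<Union>\<C> \<in> sigma_sets X (cylinder_algebra X)"
      by (rule sigma_sets_UNION[OF \<open>countable \<C>\<close>]) (simp add: \<C>_def sigma_sets.Basic)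
    ultimately show "X \<inter> U \<in> sigma_sets X (cylinder_algebra X)" by simp
  qed
  have "X \<inter> S \<in> sigma_sets X (cylinder_algebra X)"
    if "S \<in> sigma_sets UNIV {U. open U}" for S :: "(int \<Rightarrow> 'a) set"
    using that
  proof (induction rule: sigma_sets.induct)
    case (Basic U)
    then show ?case by (simp add: basic)
  next
    case Empty
    then show ?case by (simp add: sigma_sets.Empty)
  next
    case (Compl S)
    have "X \<inter> (UNIV - S) = X - X \<inter> S" by blast
    then show ?case using Compl.IH by (simp only: sigma_sets.Compl)
  next
    case (Union S)
    have "X \<inter> (\<Union>i. S i) = (\<Union>i. X \<inter> S i)" by blast
    then show ?case using Union.IH by (simp only: sigma_sets.Union)
  qed
  then show "sets (restrict_space borel X) \<subseteq> sigma_sets X (cylinder_algebra X)"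
    by (auto simp: sets_restrict_space sets_borel)
  have "cylinder_algebra X \<subseteq> sets (restrict_space borel X)"
  proof
    fix C assume "C \<in> cylinder_algebra X"
    then obtain U where "open U" "C = X \<inter> U" by (rule cylinder_algebra_open)
    then show "C \<in> sets (restrict_space borel X)"
      by (auto simp: sets_restrict_space)
  qed
  then show "sigma_sets X (cylinder_algebra X) \<subseteq> sets (restrict_space borel X)"
    using sets.sigma_sets_subset[of "cylinder_algebra X" "restrict_space borel X"]
    by (simp add: space_restrict_space)
qed

lemma saturated_vimage_shift:
  assumes "subshift X" "saturated X N C"
  shows "saturated X (Suc N) {x\<in>X. shift x \<in> C}"
proof -
  have "agree N (shift x) (shift y)" if "agree (Suc N) x y" for x y :: "int \<Rightarrow> 'a"
    using that by (auto simp: agree_def shift_def)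
  moreover have "shift x \<in> X" if "x \<in> X" for x
    using that assms(1) by (auto simp: subshift_def)
  ultimately show ?thesis
    using assms(2) by (auto simp: saturated_def)
qed

lemma funpow_shift_apply: "(shift ^^ n) x i = x (i + int n)"
  by (simp add: funpow_shift_eq_shift_pow shift_pow_def)

lemma funpow_shift_in: "subshift X \<Longrightarrow> x \<in> X \<Longrightarrow> (shift ^^ n) x \<in> X"
  by (induction n) (auto simp: subshift_def)

section \<open>Specification as gluing of words\<close>

lemma shift_dist_agree: "agree N x y \<Longrightarrow> shift_dist x y \<le> (1/2) ^ Suc N"
proof (cases "x = y")
  case False
  assume a: "agree N x y"
  define K where "K = (LEAST k. \<exists>n::int. k = nat \<bar>n\<bar> \<and> x n \<noteq> y n)"
  have "\<exists>k. \<exists>n::int. k = nat \<bar>n\<bar> \<and> x n \<noteq> y n"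
    using False by auto
  then have "\<exists>n::int. K = nat \<bar>n\<bar> \<and> x n \<noteq> y n"
    unfolding K_def by (rule LeastI_ex)
  then obtain n where n: "K = nat \<bar>n\<bar>" "x n \<noteq> y n" by blast
  have "Suc N \<le> K"
    using a n unfolding agree_def by (metis nat_le_iff not_less_eq_eq)
  then show ?thesis
    using False by (simp add: shift_dist_def K_def[symmetric] power_decreasing del: power_Suc)
qed (simp add: shift_dist_def)

lemma shift_dist_eq_one: "x 0 \<noteq> y 0 \<Longrightarrow> shift_dist x y = 1"
proof -
  assume ne: "x 0 \<noteq> y 0"
  have "(LEAST k. \<exists>n::int. k = nat \<bar>n\<bar> \<and> x n \<noteq> y n) = 0"
    by (rule Least_equality) (use ne in \<open>auto intro: exI[of _ 0]\<close>)
  then show ?thesis using ne by (auto simp: shift_dist_def)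
qed

lemma shift_dist_le_one: "shift_dist x y \<le> 1"
  by (simp add: shift_dist_def power_le_one)

lemma shift_dist_nonneg: "0 \<le> shift_dist x y"
  by (simp add: shift_dist_def)

text \<open>
  Specification in terms of symbols instead of distances. It does not mention a scale, so it can be
  passed from a subshift to a factor without comparing expansivity constants.
\<close>

definition glues :: "(int \<Rightarrow> 'a) set \<Rightarrow> (nat \<Rightarrow> nat) \<Rightarrow> bool" where
  "glues X f \<longleftrightarrow>
     (\<forall>k\<ge>1::nat. \<forall>xs ns ms.
        (\<forall>i\<in>{1..k}. xs i \<in> X) \<and> (\<forall>i\<in>{1..k}. ns i > 0) \<and>
        (\<forall>i\<in>{1..<k}. ms i \<ge> max (f (ns i)) (f (ns (i + 1)))) \<longrightarrow>
        (\<exists>z\<in>X. \<forall>i\<in>{1..k}. \<forall>m<ns i. z (int (m + (\<Sum>j=1..<i. ns j + ms j))) = xs i (int m)))"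

lemma gluesD:
  assumes "glues X f" "k \<ge> (1::nat)" "\<And>i. i \<in> {1..k} \<Longrightarrow> xs i \<in> X" "\<And>i. i \<in> {1..k} \<Longrightarrow> ns i > 0"
    and "\<And>i. i \<in> {1..<k} \<Longrightarrow> ms i \<ge> max (f (ns i)) (f (ns (i + 1)))"
  obtains z where "z \<in> X"
    "\<And>i m. i \<in> {1..k} \<Longrightarrow> m < ns i \<Longrightarrow> z (int (m + (\<Sum>j=1..<i. ns j + ms j))) = xs i (int m)"
proof -
  have "\<exists>z\<in>X. \<forall>i\<in>{1..k}. \<forall>m<ns i. z (int (m + (\<Sum>j=1..<i. ns j + ms j))) = xs i (int m)"
    using assms(3-5)
    by (intro assms(1)[unfolded glues_def, rule_format, OF assms(2)] conjI ballI) assumption+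
  then show ?thesis using that by blast
qed

text \<open>
  Points that differ at the origin have distance \<open>1\<close>, the largest possible value. An expansivity
  constant of a set with two different points is therefore less than \<open>1\<close>, and shadowing at such
  a scale prescribes the symbol at the origin.
\<close>

lemma specification_imp_glues:
  assumes "subshift X" "expansivity_constant X \<delta>" "nonuniform_specification X f \<delta>"
  shows "glues X f"
  unfolding glues_def
proof (intro allI impI)
  fix k :: nat and xs :: "nat \<Rightarrow> int \<Rightarrow> 'a" and ns ms
  assume k: "1 \<le> k"
    and *: "(\<forall>i\<in>{1..k}. xs i \<in> X) \<and> (\<forall>i\<in>{1..k}. 0 < ns i) \<and>
           (\<forall>i\<in>{1..<k}. max (f (ns i)) (f (ns (i + 1))) \<le> ms i)"
  obtain z where z: "z \<in> X" "shadows \<delta> k xs ns ms z"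
    using assms(3)[unfolded nonuniform_specification_def, rule_format, OF k *] by (elim bexE)
  show "\<exists>z\<in>X. \<forall>i\<in>{1..k}. \<forall>m<ns i. z (int (m + (\<Sum>j=1..<i. ns j + ms j))) = xs i (int m)"
  proof (rule bexI[OF _ z(1)], intro ballI allI impI)
    fix i m assume i: "i \<in> {1..k}" and m: "m < ns i"
    define u where "u = (shift ^^ (m + (\<Sum>j=1..<i. ns j + ms j))) z"
    define v where "v = (shift ^^ m) (xs i)"
    have uv: "u \<in> X" "v \<in> X"
      unfolding u_def v_def using funpow_shift_in[OF assms(1)] z(1) * i by blast+
    have "u 0 = v 0"
    \<comment> \<open>equality covers the sets with a single point, where \<open>\<delta>\<close> can be arbitrarily large\<close>
    proof (cases "u = v")
      case False
      then obtain n where "\<delta> < shift_dist (shift_pow n u) (shift_pow n v)"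
        using assms(2) uv unfolding expansivity_constant_def by blast
      then have "\<delta> < 1" using shift_dist_le_one order_less_le_trans by blast
      moreover have "shift_dist u v < \<delta>"
        using z(2) i m unfolding shadows_def u_def v_def by blast
      ultimately show ?thesis using shift_dist_eq_one[of u v] by fastforce
    qed simp
    then show "z (int (m + (\<Sum>j=1..<i. ns j + ms j))) = xs i (int m)"
      unfolding u_def v_def funpow_shift_apply add_0 .
  qed
qed

lemma expansivity_constant_three_quarters: "expansivity_constant X (3/4)"
  unfolding expansivity_constant_def
proof (intro conjI ballI impI)
  fix x y :: "int \<Rightarrow> 'a" assume "x \<noteq> y"
  then obtain n where "x n \<noteq> y n" by auto
  then have "shift_pow n x 0 \<noteq> shift_pow n y 0" by (simp add: shift_pow_def)
  then have "shift_dist (shift_pow n x) (shift_pow n y) > 3/4" by (simp add: shift_dist_eq_one)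
  then show "\<exists>n. shift_dist (shift_pow n x) (shift_pow n y) > 3/4" ..
qed simp

lemma glues_imp_specification: "glues X f \<Longrightarrow> nonuniform_specification X f (3/4)"
  unfolding nonuniform_specification_def
proof (intro allI impI)
  fix k :: nat and xs :: "nat \<Rightarrow> int \<Rightarrow> 'a" and ns ms
  assume g: "glues X f" and k: "1 \<le> k"
    and *: "(\<forall>i\<in>{1..k}. xs i \<in> X) \<and> (\<forall>i\<in>{1..k}. 0 < ns i) \<and>
           (\<forall>i\<in>{1..<k}. max (f (ns i)) (f (ns (i + 1))) \<le> ms i)"
  obtain z where z: "z \<in> X"
    "\<And>i m. i \<in> {1..k} \<Longrightarrow> m < ns i \<Longrightarrow> z (int (m + (\<Sum>j=1..<i. ns j + ms j))) = xs i (int m)"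
    using gluesD[OF g k, of xs ns ms] * by blast
  have "shadows (3/4) k xs ns ms z"
    unfolding shadows_def
  proof (intro ballI allI impI)
    fix i m assume "i \<in> {1..k}" "m < ns i"
    from z(2)[OF this]
    have "agree 0 ((shift ^^ (m + (\<Sum>j=1..<i. ns j + ms j))) z) ((shift ^^ m) (xs i))"
      by (simp only: agree_def funpow_shift_apply) simp
    from shift_dist_agree[OF this]
    show "shift_dist ((shift ^^ (m + (\<Sum>j=1..<i. ns j + ms j))) z) ((shift ^^ m) (xs i)) < 3/4"
      by simp
  qed
  then show "\<exists>z\<in>X. shadows (3/4) k xs ns ms z" using z(1) by blast
qed

lemma spec_class_iff_glues:
  "X \<in> spec_class \<longleftrightarrow>
     subshift X \<and> (\<exists>f. mono f \<and> glues X f \<and> liminf (\<lambda>n. ereal (real (f n) / ln (real n))) = 0)"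
  unfolding spec_class_def
  using specification_imp_glues glues_imp_specification expansivity_constant_three_quarters
  by blast

section \<open>Factors\<close>

text \<open>
  The points whose image at the origin is not decided by their symbols in the window \<open>-N, \<dots>, N\<close>
  form a cylinder set. These sets decrease with \<open>N\<close>, and continuity says that their intersection
  is empty.
\<close>

lemma block_code:
  fixes X :: "(int \<Rightarrow> 'a::{finite,discrete_topology}) set"
    and \<pi> :: "(int \<Rightarrow> 'a) \<Rightarrow> (int \<Rightarrow> 'b::discrete_topology)"
  assumes "closed X" "continuous_on X \<pi>"
  obtains r where "\<And>x y. x \<in> X \<Longrightarrow> y \<in> X \<Longrightarrow> agree r x y \<Longrightarrow> \<pi> x 0 = \<pi> y 0"
proof -
  define B where "B N = {x\<in>X. \<exists>y\<in>X. agree N x y \<and> \<pi> x 0 \<noteq> \<pi> y 0}" for N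
  have "saturated X N (B N)" for N
    unfolding saturated_def
  proof (intro conjI ballI impI)
    fix x y assume "x \<in> B N" and y: "y \<in> X" and xy: "agree N x y"
    then obtain x' where x': "x \<in> X" "x' \<in> X" "agree N x x'" "\<pi> x 0 \<noteq> \<pi> x' 0"
      by (auto simp: B_def)
    have "agree N y x" "agree N y x'"
      using xy x'(3) agree_sym agree_trans by blast+
    moreover have "\<pi> y 0 \<noteq> \<pi> x 0 \<or> \<pi> y 0 \<noteq> \<pi> x' 0" using x'(4) by auto
    ultimately show "y \<in> B N" using y x'(1,2) unfolding B_def by blast
  qed (auto simp: B_def)
  then have "range B \<subseteq> cylinder_algebra X"
    by (auto intro: cylinder_algebraI)
  moreover have "decseq B"
    by (rule antimonoI) (auto simp: B_def dest: agree_mono)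
  moreover have "(\<Inter>N. B N) = {}"
  proof -
    have "\<exists>N. x \<notin> B N" if x: "x \<in> X" for x
    proof -
      have "open {z :: int \<Rightarrow> 'b. agree 0 (\<pi> x) z}" by (rule open_agree)
      then obtain U where U: "open U" "U \<inter> X = \<pi> -` {z. agree 0 (\<pi> x) z} \<inter> X"
        using assms(2) unfolding continuous_on_open_invariant by blast
      have "x \<in> U" using U(2) x by auto
      then obtain N where N: "{y. agree N x y} \<subseteq> U"
        using open_contains_agree[OF U(1)] by blast
      have "\<pi> x 0 = \<pi> y 0" if "y \<in> X" "agree N x y" for y
      proof -
        have "y \<in> U \<inter> X" using N that by auto
        then have "agree 0 (\<pi> x) (\<pi> y)" using U(2) by auto
        then show ?thesis by (simp add: agree_def)
      qed
      then have "x \<notin> B N" unfolding B_def by blast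
      then show ?thesis ..
    qed
    moreover have "B N \<subseteq> X" for N by (auto simp: B_def)
    ultimately show ?thesis by blast
  qed
  ultimately obtain r where "B r = {}"
    using decseq_cylinder_empty[OF assms(1)] by blast
  then have "\<pi> x 0 = \<pi> y 0" if "x \<in> X" "y \<in> X" "agree r x y" for x y
    using that unfolding B_def by blast
  then show ?thesis by (rule that)
qed

lemma shift_pow_in:
  assumes "subshift X" "x \<in> X"
  shows "shift_pow k x \<in> X"
proof -
  have fwd: "shift_pow (int n) y \<in> X" if "y \<in> X" for n y
    using funpow_shift_in[OF assms(1) that, of n] by (simp add: funpow_shift_eq_shift_pow)
  have bwd: "\<exists>y\<in>X. (shift ^^ n) y = x" for n
  proof (induction n)
    case (Suc n)
    then obtain y where "y \<in> X" "(shift ^^ n) y = x" by blast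
    moreover from \<open>y \<in> X\<close> obtain y' where "y' \<in> X" "y = shift y'"
      using assms(1) unfolding subshift_def by blast
    ultimately have "(shift ^^ Suc n) y' = x" by (simp only: funpow_Suc_right o_apply)
    then show ?case using \<open>y' \<in> X\<close> by blast
  qed (use assms(2) in simp)
  show ?thesis
  proof (cases "k \<ge> 0")
    case True
    then show ?thesis using fwd[OF assms(2), of "nat k"] by simp
  next
    case False
    obtain y where y: "y \<in> X" "(shift ^^ nat (- k)) y = x" using bwd by blast
    have "shift_pow k x i = y i" for i
      using False by (simp add: shift_pow_def y(2)[symmetric] funpow_shift_apply)
    then have "shift_pow k x = y" ..
    then show ?thesis using y(1) by simp
  qed
qed

text \<open>
  Since \<open>ln (n + c)\<close> and \<open>ln n\<close> are asymptotically equal and \<open>d\<close> is negligible against both, a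
  positive lower bound \<open>e\<close> for the modified ratios would give the lower bound \<open>e / 2\<close> for the
  original ones.
\<close>

lemma liminf_gap_shift:
  fixes f :: "nat \<Rightarrow> nat"
  assumes "liminf (\<lambda>n. ereal (real (f n) / ln (real n))) = 0"
  shows "liminf (\<lambda>n. ereal (real (f (n + c) + d) / ln (real n))) = 0"
proof (rule antisym)
  show "0 \<le> liminf (\<lambda>n. ereal (real (f (n + c) + d) / ln (real n)))"
    by (intro Liminf_bounded eventually_sequentiallyI[of 1]) simp
  show "liminf (\<lambda>n. ereal (real (f (n + c) + d) / ln (real n))) \<le> 0"
  proof (rule ccontr)
    assume "\<not> ?thesis"
    then have "0 < liminf (\<lambda>n. ereal (real (f (n + c) + d) / ln (real n)))" by simp
    then obtain e where e: "0 < ereal e" "ereal e < liminf (\<lambda>n. ereal (real (f (n + c) + d) / ln (real n)))"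
      using ereal_dense2 by blast
    have "eventually (\<lambda>n. ereal e < ereal (real (f (n + c) + d) / ln (real n))) sequentially"
      using e(2) by (rule less_LiminfD)
    then have "eventually (\<lambda>n. e < real (f (n + c) + d) / ln (real n)) sequentially" by simp
    moreover have "eventually (\<lambda>n. e / 2 * ln (real (n + c)) + real d \<le> e * ln (real n)) sequentially"
      using e(1) by simp real_asymp
    moreover have "eventually (\<lambda>n. (1::nat) < n) sequentially" by (rule eventually_gt_at_top)
    ultimately have "eventually (\<lambda>n. e / 2 \<le> real (f (n + c)) / ln (real (n + c))) sequentially"
    proof eventually_elim
      case (elim n)
      have "0 < ln (real n)" "0 < ln (real (n + c))" using elim(3) by auto
      then show ?case using elim(1,2) by (simp add: field_simps)
    qed
    then have "eventually (\<lambda>n. ereal (e / 2) \<le> ereal (real (f (n + c)) / ln (real (n + c)))) sequentially"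
      by simp
    then have "eventually (\<lambda>n. ereal (e / 2) \<le> ereal (real (f n) / ln (real n))) sequentially"
      by (rule eventually_sequentially_seg[THEN iffD1])
    then have "ereal (e / 2) \<le> 0" using Liminf_bounded assms by metis
    then show False using e(1) by simp
  qed
qed

text \<open>
  Let \<open>r\<close> be the radius of the block code. A word of length \<open>n\<close> of the factor is the image of a word
  of length \<open>n + 2 r\<close>, which occupies \<open>r\<close> symbols of the gap on either side; both changes of the
  gap function are invisible at the scale \<open>ln n\<close>.
\<close>

lemma spec_class_factor:
  fixes X :: "(int \<Rightarrow> 'a::{finite,discrete_topology}) set"
    and Y :: "(int \<Rightarrow> 'b::{finite,discrete_topology}) set"
  assumes "X \<in> spec_class" "subshift Y" "subshift_factor_map X Y \<pi>"
  shows "Y \<in> spec_class"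
proof -
  from assms(1) obtain f where X: "subshift X" and f: "mono f" "glues X f"
    "liminf (\<lambda>n. ereal (real (f n) / ln (real n))) = 0"
    unfolding spec_class_iff_glues by blast
  have \<pi>: "continuous_on X \<pi>" "\<pi> ` X = Y" "\<And>x. x \<in> X \<Longrightarrow> \<pi> (shift x) = shift (\<pi> x)"
    using assms(3) by (auto simp: subshift_factor_map_def)
  have \<pi>_funpow: "\<pi> ((shift ^^ n) x) = (shift ^^ n) (\<pi> x)" if "x \<in> X" for x n
    by (induction n) (use that \<pi>(3) funpow_shift_in[OF X that] in auto)
  obtain r where r: "\<And>x y. x \<in> X \<Longrightarrow> y \<in> X \<Longrightarrow> agree r x y \<Longrightarrow> \<pi> x 0 = \<pi> y 0"
    using block_code[OF _ \<pi>(1)] X unfolding subshift_def by blast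
  define g where "g n = f (n + 2 * r) + 2 * r" for n
  have "mono g"
    using f(1) by (auto simp: g_def mono_def)
  moreover have "liminf (\<lambda>n. ereal (real (g n) / ln (real n))) = 0"
    unfolding g_def by (rule liminf_gap_shift[OF f(3)])
  moreover have "glues Y g"
    unfolding glues_def
  proof (intro allI impI)
    fix k :: nat and ys :: "nat \<Rightarrow> int \<Rightarrow> 'b" and ns ms
    assume k: "1 \<le> k"
      and *: "(\<forall>i\<in>{1..k}. ys i \<in> Y) \<and> (\<forall>i\<in>{1..k}. 0 < ns i) \<and>
             (\<forall>i\<in>{1..<k}. max (g (ns i)) (g (ns (i + 1))) \<le> ms i)"
    have "\<forall>i\<in>{1..k}. \<exists>x\<in>X. ys i = \<pi> x" using * \<pi>(2) by blast
    then obtain xs where xs: "\<And>i. i \<in> {1..k} \<Longrightarrow> xs i \<in> X \<and> ys i = \<pi> (xs i)" by metis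
    define xs' where "xs' i = shift_pow (- int r) (xs i)" for i
    define ns' where "ns' i = ns i + 2 * r" for i
    define ms' where "ms' i = ms i - 2 * r" for i
    obtain z where z: "z \<in> X"
      "\<And>i m. i \<in> {1..k} \<Longrightarrow> m < ns' i \<Longrightarrow>
          z (int (m + (\<Sum>j=1..<i. ns' j + ms' j))) = xs' i (int m)"
    proof (rule gluesD[OF f(2) k, of xs' ns' ms'])
      show "xs' i \<in> X" if "i \<in> {1..k}" for i
        unfolding xs'_def using xs[OF that] by (intro shift_pow_in[OF X]) simp
      show "0 < ns' i" if "i \<in> {1..k}" for i
        using * that by (auto simp: ns'_def)
      show "max (f (ns' i)) (f (ns' (i + 1))) \<le> ms' i" if "i \<in> {1..<k}" for i
      proof -
        have "max (g (ns i)) (g (ns (i + 1))) \<le> ms i" using * that by blast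
        then show ?thesis by (simp add: g_def ns'_def ms'_def) arith
      qed
    qed blast
    \<comment> \<open>lengthening the words and shortening the gaps by the same amount keeps the starting positions\<close>
    have sums: "(\<Sum>j=1..<i. ns' j + ms' j) = (\<Sum>j=1..<i. ns j + ms j)" if "i \<in> {1..k}" for i
    proof (rule sum.cong[OF refl])
      fix j assume "j \<in> {1..<i}"
      then have "max (g (ns j)) (g (ns (j + 1))) \<le> ms j" using * that by auto
      then show "ns' j + ms' j = ns j + ms j" by (simp add: g_def ns'_def ms'_def)
    qed
    define z' where "z' = (shift ^^ r) z"
    have z': "z' \<in> X" unfolding z'_def by (rule funpow_shift_in[OF X z(1)])
    have "\<pi> z' (int (m + (\<Sum>j=1..<i. ns j + ms j))) = ys i (int m)"
      if i: "i \<in> {1..k}" and m: "m < ns i" for i m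
    proof -
      define s where "s = (\<Sum>j=1..<i. ns j + ms j)"
      have "agree r ((shift ^^ (m + s)) z') ((shift ^^ m) (xs i))"
        unfolding agree_def
      proof (intro allI impI)
        fix l :: int assume l: "\<bar>l\<bar> \<le> int r"
        define m' where "m' = nat (l + int m + int r)"
        have m': "int m' = l + int m + int r" using l by (simp add: m'_def)
        have "m' < ns' i" using l m m' by (simp add: ns'_def)
        from z(2)[OF i this] have "z (int (m' + s)) = xs' i (int m')"
          unfolding sums[OF i] s_def .
        then show "(shift ^^ (m + s)) z' l = (shift ^^ m) (xs i) l"
          by (simp add: z'_def xs'_def funpow_shift_apply shift_pow_def m' algebra_simps)
      qed
      then have "\<pi> ((shift ^^ (m + s)) z') 0 = \<pi> ((shift ^^ m) (xs i)) 0"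
        using xs[OF i] z' funpow_shift_in[OF X] by (intro r) auto
      then show ?thesis
        using xs[OF i] z' by (simp add: \<pi>_funpow funpow_shift_apply s_def)
    qed
    moreover have "\<pi> z' \<in> Y" using z' \<pi>(2) by blast
    ultimately show "\<exists>z\<in>Y. \<forall>i\<in>{1..k}. \<forall>m<ns i.
        z (int (m + (\<Sum>j=1..<i. ns j + ms j))) = ys i (int m)"
      by blast
  qed
  ultimately show ?thesis
    unfolding spec_class_iff_glues using assms(2) by blast
qed

section \<open>Limits of empirical measures\<close>

text \<open>
  The integral of \<open>g\<close> with respect to the empirical measure that the orbit segments of length \<open>n\<close>
  of the points of \<open>E\<close> carry.
\<close>

definition orbit_average :: "(int \<Rightarrow> 'a) set \<Rightarrow> nat \<Rightarrow> ((int \<Rightarrow> 'a) \<Rightarrow> real) \<Rightarrow> real" where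
  "orbit_average E n g = (\<Sum>x\<in>E. \<Sum>p<n. g ((shift ^^ p) x)) / (real n * real (card E))"

lemma orbit_average_cong:
  assumes "subshift X" "E \<subseteq> X" "\<And>x. x \<in> X \<Longrightarrow> g x = h x"
  shows "orbit_average E n g = orbit_average E n h"
  unfolding orbit_average_def using assms funpow_shift_in[OF assms(1)]
  by (intro arg_cong2[where f = "(/)"] sum.cong) auto

lemma orbit_average_mono:
  assumes "subshift X" "E \<subseteq> X" "\<And>x. x \<in> X \<Longrightarrow> g x \<le> h x"
  shows "orbit_average E n g \<le> orbit_average E n h"
  unfolding orbit_average_def using assms funpow_shift_in[OF assms(1)]
  by (intro divide_right_mono sum_mono) auto

lemma orbit_average_add:
  "orbit_average E n (\<lambda>x. g x + h x) = orbit_average E n g + orbit_average E n h"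
  by (simp add: orbit_average_def sum.distrib add_divide_distrib)

lemma orbit_average_cmult:
  "orbit_average E n (\<lambda>x. c * g x) = c * orbit_average E n g"
  by (simp add: orbit_average_def sum_distrib_left)

lemma orbit_average_sum:
  "orbit_average E n (\<lambda>x. \<Sum>v\<in>V. g v x) = (\<Sum>v\<in>V. orbit_average E n (g v))"
proof (cases "finite V")
  case True
  then show ?thesis
    by (induction V rule: finite_induct) (simp_all add: orbit_average_add, simp add: orbit_average_def)
qed (simp add: orbit_average_def)

lemma orbit_average_const:
  assumes "finite E" "E \<noteq> {}" "n > 0"
  shows "orbit_average E n (\<lambda>_. c) = c"
  using assms by (simp add: orbit_average_def)

text \<open>
  Along one orbit the difference telescopes to two boundary terms. Hence limits of empirical
  measures are invariant.
\<close>

lemma orbit_average_shift: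
  assumes "finite E" "E \<noteq> {}" "n > 0" "\<And>x. \<bar>g x\<bar> \<le> 1"
  shows "\<bar>orbit_average E n (\<lambda>x. g (shift x)) - orbit_average E n g\<bar> \<le> 2 / real n"
proof -
  have "(\<Sum>p<n. g (shift ((shift ^^ p) x))) - (\<Sum>p<n. g ((shift ^^ p) x))
          = g ((shift ^^ n) x) - g x" for x
    using sum_lessThan_telescope[of "\<lambda>p. g ((shift ^^ p) x)" n] by (simp add: sum_subtractf)
  then have "orbit_average E n (\<lambda>x. g (shift x)) - orbit_average E n g
        = (\<Sum>x\<in>E. g ((shift ^^ n) x) - g x) / (real n * real (card E))"
    unfolding orbit_average_def diff_divide_distrib[symmetric] sum_subtractf[symmetric]
    by (simp add: sum_subtractf)
  then have "\<bar>orbit_average E n (\<lambda>x. g (shift x)) - orbit_average E n g\<bar>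
        = \<bar>\<Sum>x\<in>E. g ((shift ^^ n) x) - g x\<bar> / (real n * real (card E))"
    by simp
  also have "\<dots> \<le> (\<Sum>x\<in>E. 2) / (real n * real (card E))"
  proof (intro divide_right_mono order.trans[OF sum_abs sum_mono])
    fix x show "\<bar>g ((shift ^^ n) x) - g x\<bar> \<le> 2"
      using assms(4)[of x] assms(4)[of "(shift ^^ n) x"] by linarith
  qed simp
  also have "\<dots> = 2 / real n"
    using assms(1-3) by simp
  finally show ?thesis .
qed

text \<open>
  A diagonal argument over the countably many cylinder sets, in the form of sequential compactness
  of a countable power of the unit interval.
\<close>

lemma bounded_family_subseq:
  fixes F :: "nat \<Rightarrow> 'c \<Rightarrow> real"
  assumes "countable A" "\<And>k C. F k C \<in> {0..1}"
  obtains r l where "strict_mono r" "\<And>C. C \<in> A \<Longrightarrow> (\<lambda>k. F (r k) C) \<longlonglongrightarrow> l C"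
proof -
  define G where "G k i = F k (from_nat_into A i)" for k i
  have "compactin (product_topology (\<lambda>_::nat. euclidean :: real topology) UNIV) (PiE UNIV (\<lambda>_. {0..1}))"
    unfolding compactin_PiE by simp
  then have "compact (PiE UNIV (\<lambda>_::nat. {0..1::real}))"
    by (simp add: euclidean_product_topology)
  then have "seq_compact (PiE UNIV (\<lambda>_::nat. {0..1::real}))"
    by (rule compact_imp_seq_compact)
  moreover have "\<forall>k. G k \<in> PiE UNIV (\<lambda>_::nat. {0..1::real})"
    using assms(2) unfolding G_def by (simp add: PiE_UNIV_domain)
  ultimately obtain l r where lr: "strict_mono r" "(G \<circ> r) \<longlonglongrightarrow> l"
    by (rule seq_compactE)
  have G: "(\<lambda>k. G (r k) i) \<longlonglongrightarrow> l i" for i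
  proof -
    have "isCont (\<lambda>x::nat \<Rightarrow> real. x i) l"
      using continuous_on_eq_continuous_at[OF open_UNIV, THEN iffD1,
          OF continuous_on_product_coordinates] by blast
    then show ?thesis
      using isCont_tendsto_compose[OF _ lr(2), of "\<lambda>x. x i"] by (simp add: o_def)
  qed
  show ?thesis
  proof
    show "(\<lambda>k. F (r k) C) \<longlonglongrightarrow> l (to_nat_on A C)" if "C \<in> A" for C
      using G[of "to_nat_on A C"] assms(1) that by (simp add: G_def)
  qed (rule lr(1))
qed

lemma orbit_average_indicator_bounds:
  assumes "finite E"
  shows "orbit_average E n (indicator C) \<in> {0..1}"
proof -
  have "(\<Sum>x\<in>E. \<Sum>p<n. indicator C ((shift ^^ p) x)) \<le> (\<Sum>x\<in>E. \<Sum>p<n. (1::real))"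
    by (intro sum_mono) (simp add: indicator_def)
  then show ?thesis
    unfolding orbit_average_def
    by (auto intro!: divide_nonneg_nonneg sum_nonneg divide_le_eq_1[THEN iffD2] simp: mult.commute)
qed

lemma space_subshift_measure:
  "sets \<nu> = sets (restrict_space borel X) \<Longrightarrow> space \<nu> = X"
  using sets_eq_imp_space_eq[of \<nu> "restrict_space borel X"] by (simp add: space_restrict_space)

lemma measurable_shift:
  fixes X :: "(int \<Rightarrow> 'a::{finite,discrete_topology}) set"
  assumes X: "subshift X" and \<nu>: "sets \<nu> = sets (restrict_space borel X)"
  shows "shift \<in> measurable \<nu> \<nu>"
proof (rule measurable_sigma_sets)
  show sets: "sets \<nu> = sigma_sets X (cylinder_algebra X)"
    using \<nu> by (simp add: sigma_sets_cylinder_algebra)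
  show "cylinder_algebra X \<subseteq> Pow X"
    using algebra_cylinder_algebra[of X] by (simp add: algebra_iff_Un)
  have space: "space \<nu> = X" by (rule space_subshift_measure[OF \<nu>])
  show "shift \<in> space \<nu> \<rightarrow> X" using X by (auto simp: space subshift_def)
  fix C assume "C \<in> cylinder_algebra X"
  then have "{x\<in>X. shift x \<in> C} \<in> cylinder_algebra X"
    using saturated_vimage_shift[OF X] by (auto simp: cylinder_algebra_def)
  moreover have "shift -` C \<inter> space \<nu> = {x\<in>X. shift x \<in> C}" by (auto simp: space)
  ultimately show "shift -` C \<inter> space \<nu> \<in> sets \<nu>"
    by (simp add: sets sigma_sets.Basic)
qed

text \<open>
  Along a subsequence the frequencies of all cylinder sets converge. The limits are additive, and
  a decreasing sequence of cylinder sets with empty intersection is eventually empty, so the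
  limits extend to a measure by Caratheodory's theorem.
\<close>

lemma orbit_average_limit:
  fixes X :: "(int \<Rightarrow> 'a::{finite,discrete_topology}) set"
  assumes X: "subshift X"
    and E: "\<And>k. finite (E k)" "\<And>k. E k \<noteq> {}" "\<And>k. E k \<subseteq> X"
    and n: "filterlim n at_top sequentially"
  obtains \<nu> r where "\<nu> \<in> invariant_measures X" "strict_mono r"
    "\<And>C. C \<in> cylinder_algebra X \<Longrightarrow>
       (\<lambda>k. orbit_average (E (r k)) (n (r k)) (indicator C)) \<longlonglongrightarrow> measure \<nu> C"
proof -
  interpret alg: algebra X "cylinder_algebra X" by (rule algebra_cylinder_algebra)
  obtain r l where r: "strict_mono r" and l: "\<And>C. C \<in> cylinder_algebra X \<Longrightarrow>
       (\<lambda>k. orbit_average (E (r k)) (n (r k)) (indicator C)) \<longlonglongrightarrow> l C"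
    using bounded_family_subseq[OF countable_cylinder_algebra[of X],
        of "\<lambda>k C. orbit_average (E k) (n k) (indicator C)"]
      orbit_average_indicator_bounds[OF E(1)] by blast
  have nr: "filterlim (\<lambda>k. n (r k)) at_top sequentially"
    using filterlim_compose[OF n filterlim_subseq[OF r]] .
  have pos: "eventually (\<lambda>k. n (r k) > 0) sequentially"
    by (rule eventually_compose_filterlim[OF eventually_gt_at_top nr])
  have l_nonneg: "0 \<le> l C" if "C \<in> cylinder_algebra X" for C
    using l[OF that] orbit_average_indicator_bounds[OF E(1)]
    by (intro LIMSEQ_le_const[OF l[OF that]]) auto
  have l_Un: "l (C \<union> D) = l C + l D"
    if "C \<in> cylinder_algebra X" "D \<in> cylinder_algebra X" "C \<inter> D = {}" for C D
  proof (rule LIMSEQ_unique[OF l[OF alg.Un[OF that(1,2)]]])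
    have "indicator (C \<union> D) = (\<lambda>x. indicator C x + indicator D x :: real)"
      using that(3) by (auto simp: indicator_def fun_eq_iff)
    then show "(\<lambda>k. orbit_average (E (r k)) (n (r k)) (indicator (C \<union> D))) \<longlonglongrightarrow> l C + l D"
      using tendsto_add[OF l[OF that(1)] l[OF that(2)]] by (simp add: orbit_average_add)
  qed
  have l_empty: "l {} = 0"
    using l_Un[of "{}" "{}"] by simp
  have l_space: "l X = 1"
  proof (rule LIMSEQ_unique[OF l[OF alg.top]])
    have eq: "orbit_average (E (r k)) (n (r k)) (indicator X) = orbit_average (E (r k)) (n (r k)) (\<lambda>_. 1)"
      for k by (rule orbit_average_cong[OF X E(3)]) simp
    have "eventually (\<lambda>k. orbit_average (E (r k)) (n (r k)) (indicator X) = 1) sequentially"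
      using pos by eventually_elim (simp add: eq orbit_average_const E)
    then show "(\<lambda>k. orbit_average (E (r k)) (n (r k)) (indicator X)) \<longlonglongrightarrow> 1"
      by (rule tendsto_eventually)
  qed
  have l_shift: "l {x\<in>X. shift x \<in> C} = l C" if C: "C \<in> cylinder_algebra X" for C
  proof -
    have C': "{x\<in>X. shift x \<in> C} \<in> cylinder_algebra X"
      using C saturated_vimage_shift[OF X] by (auto simp: cylinder_algebra_def)
    have eq: "orbit_average (E (r k)) (n (r k)) (indicator {x\<in>X. shift x \<in> C})
            = orbit_average (E (r k)) (n (r k)) (\<lambda>x. indicator C (shift x))" for k
      by (rule orbit_average_cong[OF X E(3)]) (simp add: indicator_def)
    have "eventually (\<lambda>k. norm (orbit_average (E (r k)) (n (r k)) (indicator {x\<in>X. shift x \<in> C})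
            - orbit_average (E (r k)) (n (r k)) (indicator C)) \<le> 2 / real (n (r k))) sequentially"
      using pos
    proof eventually_elim
      case (elim k)
      show ?case
        unfolding eq real_norm_def
        by (rule orbit_average_shift) (simp_all add: E elim indicator_def)
    qed
    moreover have "(\<lambda>k. 2 / real (n (r k))) \<longlonglongrightarrow> 0"
      by (rule tendsto_divide_0[OF tendsto_const])
        (rule filterlim_compose[OF filterlim_at_top_imp_at_infinity[OF filterlim_real_sequentially] nr])
    ultimately have "(\<lambda>k. orbit_average (E (r k)) (n (r k)) (indicator {x\<in>X. shift x \<in> C})
            - orbit_average (E (r k)) (n (r k)) (indicator C)) \<longlonglongrightarrow> 0"
      by (rule Lim_null_comparison)
    from LIMSEQ_unique[OF this tendsto_diff[OF l[OF C'] l[OF C]]] show ?thesis by simp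
  qed
  have "\<exists>\<mu>. (\<forall>C\<in>cylinder_algebra X. \<mu> C = ennreal (l C)) \<and>
            measure_space X (sigma_sets X (cylinder_algebra X)) \<mu>"
  proof (rule alg.caratheodory_empty_continuous)
    show "positive (cylinder_algebra X) (\<lambda>C. ennreal (l C))"
      by (simp add: positive_def l_empty)
    show "additive (cylinder_algebra X) (\<lambda>C. ennreal (l C))"
      by (simp add: additive_def l_Un l_nonneg ennreal_plus)
    fix A :: "nat \<Rightarrow> (int \<Rightarrow> 'a) set"
    assume A: "range A \<subseteq> cylinder_algebra X" "decseq A" "(\<Inter>i. A i) = {}"
    have "closed X" using X by (simp add: subshift_def)
    then obtain i where i: "A i = {}"
      using decseq_cylinder_empty[OF _ A] by blast
    have "eventually (\<lambda>j. A j = {}) sequentially"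
      using decseqD[OF A(2), of i] i by (intro eventually_sequentiallyI[of i]) blast
    then have "eventually (\<lambda>j. ennreal (l (A j)) = 0) sequentially"
      by eventually_elim (simp add: l_empty)
    then show "(\<lambda>j. ennreal (l (A j))) \<longlonglongrightarrow> 0"
      by (rule tendsto_eventually)
  qed simp
  then obtain \<mu> where \<mu>: "\<And>C. C \<in> cylinder_algebra X \<Longrightarrow> \<mu> C = ennreal (l C)"
    "measure_space X (sigma_sets X (cylinder_algebra X)) \<mu>" by blast
  define \<nu> where "\<nu> = measure_of X (cylinder_algebra X) \<mu>"
  have space: "space \<nu> = X" and sets: "sets \<nu> = sigma_sets X (cylinder_algebra X)"
    unfolding \<nu>_def by (rule space_measure_of[OF alg.space_closed], rule sets_measure_of[OF alg.space_closed])
  have em: "emeasure \<nu> C = ennreal (l C)" if "C \<in> cylinder_algebra X" for C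
    using \<mu> that alg.space_closed
    by (simp add: \<nu>_def emeasure_measure_of_conv sigma_sets.Basic)
  have "prob_space \<nu>"
    by (rule prob_spaceI) (simp add: space em alg.top l_space)
  moreover have borel: "sets \<nu> = sets (restrict_space borel X)"
    by (simp add: sets sigma_sets_cylinder_algebra)
  moreover have "distr \<nu> \<nu> shift = \<nu>"
  proof -
    have vim: "shift -` C \<inter> space \<nu> \<in> cylinder_algebra X \<and> shift -` C \<inter> space \<nu> = {x\<in>X. shift x \<in> C}"
      if "C \<in> cylinder_algebra X" for C
    proof -
      have "shift -` C \<inter> space \<nu> = {x\<in>X. shift x \<in> C}" by (auto simp: space)
      moreover have "{x\<in>X. shift x \<in> C} \<in> cylinder_algebra X"
        using that saturated_vimage_shift[OF X] by (auto simp: cylinder_algebra_def)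
      ultimately show ?thesis by simp
    qed
    have meas: "shift \<in> measurable \<nu> \<nu>" by (rule measurable_shift[OF X borel])
    show ?thesis
    proof (rule measure_eqI_generator_eq)
      show "Int_stable (cylinder_algebra X)" by (simp add: Int_stable_def alg.Int)
      show "cylinder_algebra X \<subseteq> Pow X" by (rule alg.space_closed)
      show "emeasure (distr \<nu> \<nu> shift) C = emeasure \<nu> C" if C: "C \<in> cylinder_algebra X" for C
      proof -
        have "C \<in> sets \<nu>" using C by (simp add: sets sigma_sets.Basic)
        then have "emeasure (distr \<nu> \<nu> shift) C = emeasure \<nu> (shift -` C \<inter> space \<nu>)"
          by (rule emeasure_distr[OF meas])
        also have "\<dots> = ennreal (l (shift -` C \<inter> space \<nu>))"
          using vim[OF C] by (intro em) blast
        also have "l (shift -` C \<inter> space \<nu>) = l C"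
          using vim[OF C] l_shift[OF C] by simp
        also have "ennreal (l C) = emeasure \<nu> C" using em[OF C] by simp
        finally show ?thesis .
      qed
      show "range (\<lambda>_::nat. X) \<subseteq> cylinder_algebra X" using alg.top by blast
      show "emeasure (distr \<nu> \<nu> shift) X \<noteq> \<infinity>" for i :: nat
        using prob_space.emeasure_space_1[OF prob_space.prob_space_distr[OF \<open>prob_space \<nu>\<close> meas]]
        by (simp add: space)
    qed (simp_all add: sets)
  qed
  ultimately have "\<nu> \<in> invariant_measures X" by (simp add: invariant_measures_def)
  moreover have "(\<lambda>k. orbit_average (E (r k)) (n (r k)) (indicator C)) \<longlonglongrightarrow> measure \<nu> C"
    if "C \<in> cylinder_algebra X" for C
    using l[OF that] em[OF that] l_nonneg[OF that] by (simp add: measure_def)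
  ultimately show ?thesis using r that by blast
qed

section \<open>Entropy of a stationary process\<close>

lemma finite_words [simp]: "finite {w :: 'a::finite list. length w = n}"
  using finite_lists_length_eq[of "UNIV :: 'a set" n] by simp

lemma sum_words_Cons:
  "(\<Sum>w | length w = Suc n. g w) = (\<Sum>v | length v = n. \<Sum>c\<in>(UNIV::'a::finite set). g (c # v))"
proof -
  have "(\<Sum>w | length w = Suc n. g w) = (\<Sum>(v, c)\<in>{v :: 'a list. length v = n} \<times> UNIV. g (c # v))"
    by (rule sum.reindex_bij_witness[of _ "\<lambda>(v, c). c # v" "\<lambda>w. (tl w, hd w)"])
      (auto simp: length_Suc_conv)
  then show ?thesis by (simp add: sum.cartesian_product)
qed

lemma sum_words_snoc:
  "(\<Sum>w | length w = Suc n. g w) = (\<Sum>v | length v = n. \<Sum>c\<in>(UNIV::'a::finite set). g (v @ [c]))"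
proof -
  have "(\<Sum>w | length w = Suc n. g w) = (\<Sum>(v, c)\<in>{v :: 'a list. length v = n} \<times> UNIV. g (v @ [c]))"
    by (rule sum.reindex_bij_witness[of _ "\<lambda>(v, c). v @ [c]" "\<lambda>w. (butlast w, last w)"])
      (auto simp: append_butlast_last_id simp flip: length_greater_0_conv)
  then show ?thesis by (simp add: sum.cartesian_product)
qed

text \<open>
  Here \<open>p w\<close> is the probability of reading \<open>w\<close> at the origin. Extension to the right expresses
  additivity, extension to the left stationarity.
\<close>

locale stationary_process =
  fixes p :: "'a::finite list \<Rightarrow> real"
  assumes nonneg: "0 \<le> p w"
    and Nil: "p [] = 1"
    and extend_right: "(\<Sum>c\<in>UNIV. p (w @ [c])) = p w"
    and extend_left: "(\<Sum>c\<in>UNIV. p (c # w)) = p w"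
begin

definition block_entropy :: "nat \<Rightarrow> real" where
  "block_entropy q = - (\<Sum>w | length w = q. p w * ln (p w))"

lemma sum_eq_1: "(\<Sum>w | length w = q. p w) = 1"
proof (induction q)
  case (Suc q)
  then show ?case by (simp add: sum_words_snoc extend_right)
qed (simp add: Nil)

lemma le_1: "p w \<le> 1"
  using member_le_sum[of w "{v. length v = length w}" p] sum_eq_1[of "length w"] nonneg by simp

lemma snoc_le: "p (w @ [c]) \<le> p w"
  unfolding extend_right[symmetric, of w] by (rule member_le_sum) (auto simp: nonneg)

lemma Cons_le: "p (c # w) \<le> p w"
  unfolding extend_left[symmetric, of w] by (rule member_le_sum) (auto simp: nonneg)

lemma block_entropy_0: "block_entropy 0 = 0"
  by (simp add: block_entropy_def Nil)

lemma block_entropy_nonneg: "0 \<le> block_entropy q"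
proof -
  have "p w * ln (p w) \<le> 0" for w
    using nonneg[of w] le_1[of w] by (cases "p w = 0") (auto simp: mult_nonneg_nonpos)
  then show ?thesis unfolding block_entropy_def by (simp add: sum_nonpos)
qed

text \<open>
  Conditioning reduces entropy: given the middle word \<open>v\<close>, the entropy of the pair of its two
  neighbours is at most the sum of the entropies of the neighbours. This is \<open>ln t \<le> t - 1\<close> at the
  ratio of the conditionally independent law to the actual one.
\<close>

lemma block_entropy_concave: "block_entropy (Suc (Suc q)) + block_entropy q \<le> 2 * block_entropy (Suc q)"
proof -
  define D where "D v a c = p (a # v @ [c]) * (ln (p (a # v)) + ln (p (v @ [c])) - ln (p v) - ln (p (a # v @ [c])))"
    for v a c
  have D: "D v a c \<le> p (a # v) * p (v @ [c]) / p v - p (a # v @ [c])" for v a c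
  proof (cases "p (a # v @ [c]) = 0")
    case True
    then show ?thesis by (simp add: D_def nonneg)
  next
    case False
    then have pos: "0 < p (a # v @ [c])" using nonneg[of "a # v @ [c]"] by simp
    have "p (a # v @ [c]) \<le> p (a # v)" using snoc_le[of "a # v" c] by simp
    moreover have "p (a # v @ [c]) \<le> p (v @ [c])" by (rule Cons_le)
    moreover have "p (v @ [c]) \<le> p v" by (rule snoc_le)
    ultimately have pos': "0 < p (a # v)" "0 < p (v @ [c])" "0 < p v" using pos by linarith+
    define t where "t = p (a # v) * p (v @ [c]) / (p v * p (a # v @ [c]))"
    have "0 < t" using pos pos' by (simp add: t_def)
    have "D v a c = p (a # v @ [c]) * ln t"
      using pos pos' by (simp add: D_def t_def ln_mult ln_div)
    also have "\<dots> \<le> p (a # v @ [c]) * (t - 1)"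
      using pos ln_le_minus_one[OF \<open>0 < t\<close>] by (intro mult_left_mono) auto
    also have "\<dots> = p (a # v) * p (v @ [c]) / p v - p (a # v @ [c])"
      using pos pos' by (simp add: t_def field_simps)
    finally show ?thesis .
  qed
  have "(\<Sum>c\<in>UNIV. \<Sum>a\<in>UNIV. D v a c) \<le> 0" for v
  proof -
    have "(\<Sum>c\<in>UNIV. \<Sum>a\<in>UNIV. D v a c)
        \<le> (\<Sum>c\<in>UNIV. \<Sum>a\<in>UNIV. p (a # v) * p (v @ [c]) / p v - p (a # v @ [c]))"
      by (intro sum_mono D)
    also have "\<dots> = (\<Sum>c\<in>UNIV. \<Sum>a\<in>UNIV. p (a # v) * p (v @ [c]) / p v) - p v"
      by (simp add: sum_subtractf extend_left extend_right)
    also have "(\<Sum>c\<in>UNIV. \<Sum>a\<in>UNIV. p (a # v) * p (v @ [c]) / p v)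
        = (\<Sum>c\<in>UNIV. p v * p (v @ [c]) / p v)"
      unfolding sum_divide_distrib[symmetric] sum_distrib_right[symmetric] extend_left ..
    also have "\<dots> = p v * p v / p v"
      unfolding sum_divide_distrib[symmetric] sum_distrib_left[symmetric] extend_right ..
    also have "p v * p v / p v - p v = 0" by simp
    finally show ?thesis .
  qed
  then have "(\<Sum>v | length v = q. \<Sum>c\<in>UNIV. \<Sum>a\<in>UNIV. D v a c) \<le> 0"
    by (rule sum_nonpos)
  moreover have "(\<Sum>v | length v = q. \<Sum>c\<in>UNIV. \<Sum>a\<in>UNIV. D v a c)
      = - block_entropy (Suc q) - block_entropy (Suc q) + block_entropy q + block_entropy (Suc (Suc q))"
  proof -
    have 1: "(\<Sum>v | length v = q. \<Sum>c\<in>UNIV. \<Sum>a\<in>UNIV. p (a # v @ [c]) * ln (p (a # v))) = - block_entropy (Suc q)"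
    proof -
      have "(\<Sum>c\<in>UNIV. \<Sum>a\<in>UNIV. p (a # v @ [c]) * ln (p (a # v)))
          = (\<Sum>a\<in>UNIV. p (a # v) * ln (p (a # v)))" for v
        using extend_right[of "_ # v"] by (subst sum.swap) (simp add: sum_distrib_right[symmetric])
      then show ?thesis by (simp add: block_entropy_def sum_words_Cons)
    qed
    have 2: "(\<Sum>v | length v = q. \<Sum>c\<in>UNIV. \<Sum>a\<in>UNIV. p (a # v @ [c]) * ln (p (v @ [c]))) = - block_entropy (Suc q)"
      by (simp add: block_entropy_def sum_words_snoc sum_distrib_right[symmetric] extend_left)
    have 3: "(\<Sum>v | length v = q. \<Sum>c\<in>UNIV. \<Sum>a\<in>UNIV. p (a # v @ [c]) * ln (p v)) = - block_entropy q"
      by (simp add: block_entropy_def sum_distrib_right[symmetric] extend_left extend_right)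
    have 4: "(\<Sum>v | length v = q. \<Sum>c\<in>UNIV. \<Sum>a\<in>UNIV. p (a # v @ [c]) * ln (p (a # v @ [c])))
        = - block_entropy (Suc (Suc q))"
      by (simp add: block_entropy_def sum_words_Cons[of _ "Suc q"] sum_words_snoc[of _ q])
    show ?thesis
      using 1 2 3 4 by (simp add: D_def algebra_simps sum.distrib sum_subtractf)
  qed
  ultimately show ?thesis by simp
qed

lemma block_entropy_increments_antimono: "antimono (\<lambda>q. block_entropy (Suc q) - block_entropy q)"
  by (rule decseq_SucI) (use block_entropy_concave in \<open>simp add: algebra_simps\<close>)

text \<open>
  The increments decrease and start from \<open>block_entropy 0 = 0\<close>, so \<open>block_entropy q\<close> is the
  sum of \<open>q\<close> increments that are all at least the next one. In particular \<open>block_entropy q / q\<close> decreases.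
\<close>

lemma block_entropy_ge: "real q * (block_entropy (Suc q) - block_entropy q) \<le> block_entropy q"
proof -
  have "real q * (block_entropy (Suc q) - block_entropy q) = (\<Sum>i<q. block_entropy (Suc q) - block_entropy q)" by simp
  also have "\<dots> \<le> (\<Sum>i<q. block_entropy (Suc i) - block_entropy i)"
    using antimonoD[OF block_entropy_increments_antimono] by (intro sum_mono) simp
  also have "\<dots> = block_entropy q" by (simp add: sum_lessThan_telescope block_entropy_0)
  finally show ?thesis .
qed

lemma block_entropy_rate_convergent: "convergent (\<lambda>q. block_entropy q / real q)"
proof -
  have "block_entropy (Suc (Suc q)) / real (Suc (Suc q)) \<le> block_entropy (Suc q) / real (Suc q)" for q
    using block_entropy_ge[of "Suc q"] by (simp add: field_simps)
  then have "decseq (\<lambda>q. block_entropy (Suc q) / real (Suc q))" by (rule decseq_SucI)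
  then have "convergent (\<lambda>q. block_entropy (Suc q) / real (Suc q))"
    using block_entropy_nonneg by (intro Bseq_monoseq_convergent decseq_imp_monoseq decseq_bounded[of _ 0]) auto
  then show ?thesis by (rule convergent_Suc_iff[THEN iffD1])
qed

lemma block_entropy_rate_ge:
  assumes "\<And>q. h \<le> block_entropy (Suc q) - block_entropy q"
  shows "h \<le> lim (\<lambda>q. block_entropy q / real q)"
proof (rule LIMSEQ_le_const[OF convergent_LIMSEQ_iff[THEN iffD1, OF block_entropy_rate_convergent]])
  have "h \<le> block_entropy q / real q" if "q \<ge> 1" for q
    using block_entropy_ge[of q] assms[of q] mult_left_mono[OF assms[of q], of "real q"] that
    by (simp add: field_simps)
  then show "\<exists>N. \<forall>q\<ge>N. h \<le> block_entropy q / real q" by blast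
qed

end

section \<open>Counting words\<close>

definition word :: "nat \<Rightarrow> (int \<Rightarrow> 'a) \<Rightarrow> 'a list" where
  "word n x = map (\<lambda>i. x (int i)) [0..<n]"

definition word_cylinder :: "(int \<Rightarrow> 'a) set \<Rightarrow> 'a list \<Rightarrow> (int \<Rightarrow> 'a) set" where
  "word_cylinder X w = {x\<in>X. word (length w) x = w}"

lemma length_word [simp]: "length (word n x) = n"
  by (simp add: word_def)

lemma word_Suc: "word (Suc n) x = word n x @ [x (int n)]"
  by (simp add: word_def)

lemma word_Suc_Cons: "word (Suc n) x = x 0 # word n (shift x)"
  by (simp add: word_def shift_def map_upt_Suc add.commute del: upt_Suc)

lemma word_funpow_shift: "l + m \<le> n \<Longrightarrow> word l ((shift ^^ m) x) = take l (drop m (word n x))"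
  by (rule nth_equalityI) (simp_all add: word_def funpow_shift_apply add.commute)

lemma word_cylinder_algebra: "word_cylinder X w \<in> cylinder_algebra X"
proof -
  have "word (length w) x = word (length w) y" if "agree (length w) x y" for x y :: "int \<Rightarrow> 'a"
    using that by (auto simp: word_def agree_def)
  then have "saturated X (length w) (word_cylinder X w)"
    by (auto simp: saturated_def word_cylinder_def)
  then show ?thesis by (rule cylinder_algebraI)
qed

text \<open>
  A kernel \<open>\<pi>\<close> of memory \<open>q\<close> distributes mass \<open>1\<close> among the continuations of each of the
  initial words of length \<open>q\<close>.
\<close>

lemma sum_markov_weights:
  fixes \<pi> :: "'a::finite list \<Rightarrow> real"
  assumes "\<And>v. length v = q \<Longrightarrow> (\<Sum>c\<in>UNIV. \<pi> (v @ [c])) = 1"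
  shows "(\<Sum>u | length u = q + n. \<Prod>i<n. \<pi> (take (Suc q) (drop i u))) = real (CARD('a) ^ q)"
proof (induction n)
  case 0
  show ?case using card_lists_length_eq[of "UNIV :: 'a set" q] by simp
next
  case (Suc n)
  have "(\<Sum>u | length u = q + Suc n. \<Prod>i<Suc n. \<pi> (take (Suc q) (drop i u)))
      = (\<Sum>u | length u = q + n. \<Sum>c\<in>UNIV. \<Prod>i<Suc n. \<pi> (take (Suc q) (drop i (u @ [c]))))"
    by (simp only: add_Suc_right sum_words_snoc)
  also have "\<dots> = (\<Sum>u | length u = q + n. \<Sum>c\<in>UNIV.
      (\<Prod>i<n. \<pi> (take (Suc q) (drop i u))) * \<pi> (drop n u @ [c]))"
  proof (intro sum.cong refl)
    fix u :: "'a list" and c assume "u \<in> {u. length u = q + n}"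
    then have u: "length u = q + n" by simp
    have init: "(\<Prod>i<n. \<pi> (take (Suc q) (drop i (u @ [c])))) = (\<Prod>i<n. \<pi> (take (Suc q) (drop i u)))"
      by (intro prod.cong refl) (simp add: u)
    have last: "take (Suc q) (drop n (u @ [c])) = drop n u @ [c]" using u by simp
    show "(\<Prod>i<Suc n. \<pi> (take (Suc q) (drop i (u @ [c]))))
        = (\<Prod>i<n. \<pi> (take (Suc q) (drop i u))) * \<pi> (drop n u @ [c])"
      unfolding prod.lessThan_Suc init last ..
  qed
  also have "\<dots> = (\<Sum>u | length u = q + n. \<Prod>i<n. \<pi> (take (Suc q) (drop i u)))"
    by (intro sum.cong refl) (simp add: sum_distrib_left[symmetric] assms)
  finally show ?case using Suc.IH by simp
qed

text \<open>
  Gibbs' inequality for the uniform distribution on \<open>E\<close>, obtained from \<open>ln t \<le> t - 1\<close> at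
  \<open>t = a x * card E / S\<close>.
\<close>

lemma ln_card_le_gibbs:
  fixes a :: "'c \<Rightarrow> real"
  assumes "finite E" "E \<noteq> {}" "\<And>x. x \<in> E \<Longrightarrow> 0 < a x" "(\<Sum>x\<in>E. a x) \<le> S"
  shows "ln (real (card E)) \<le> ln S - (\<Sum>x\<in>E. ln (a x)) / real (card E)"
proof -
  define m where "m = real (card E)"
  have m: "0 < m" using assms by (simp add: m_def card_gt_0_iff)
  have S: "0 < S" using sum_pos[of E a] assms by force
  have "(\<Sum>x\<in>E. ln (a x) + ln m - ln S) \<le> (\<Sum>x\<in>E. a x * m / S - 1)"
  proof (rule sum_mono)
    fix x assume "x \<in> E"
    then have "0 < a x" by (rule assms(3))
    then have "ln (a x) + ln m - ln S = ln (a x * m / S)" using m S by (simp add: ln_mult ln_div)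
    also have "\<dots> \<le> a x * m / S - 1" using \<open>0 < a x\<close> m S by (intro ln_le_minus_one) simp
    finally show "ln (a x) + ln m - ln S \<le> a x * m / S - 1" .
  qed
  also have "\<dots> = (\<Sum>x\<in>E. a x) * m / S - m"
    by (simp add: sum_subtractf m_def sum_distrib_right sum_divide_distrib)
  also have "\<dots> \<le> 0" using assms(4) m S by (simp add: field_simps)
  finally have "(\<Sum>x\<in>E. ln (a x)) + m * ln m - m * ln S \<le> 0"
    by (simp add: sum.distrib sum_subtractf m_def)
  then show ?thesis using m unfolding m_def[symmetric] by (simp add: field_simps)
qed

text \<open>
  Distinct words have Markov weights of total mass at most \<open>CARD('a) ^ q\<close>, and the logarithm of a
  Markov weight is a sum along the orbit. So for every kernel an orbit average of a function of \<open>q + 1\<close>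
  coordinates bounds the growth rate of the number of words, up to a term of order \<open>q / n\<close>. Working with kernels instead of products of
  block distributions avoids cutting the words into blocks and averaging over the position of
  the cuts.
\<close>

lemma ln_card_le_orbit_average:
  fixes \<pi> :: "'a::finite list \<Rightarrow> real"
  assumes "\<And>v. length v = q \<Longrightarrow> (\<Sum>c\<in>UNIV. \<pi> (v @ [c])) = 1" "\<And>u. length u = Suc q \<Longrightarrow> 0 < \<pi> u"
    and E: "finite E" "E \<noteq> {}" "inj_on (word n) E" and n: "n > 0"
  shows "ln (real (card E)) / real n
      \<le> real q * ln (real CARD('a)) / real n + orbit_average E n (\<lambda>x. - ln (\<pi> (word (Suc q) x)))"
proof -
  \<comment> \<open>the points are read on \<open>q + n\<close> coordinates, so that each \<open>i < n\<close> starts a window of length \<open>q + 1\<close>\<close>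
  define a where "a x = (\<Prod>i<n. \<pi> (word (Suc q) ((shift ^^ i) x)))" for x
  have a_eq: "a x = (\<Prod>i<n. \<pi> (take (Suc q) (drop i (word (q + n) x))))" for x
    unfolding a_def by (intro prod.cong refl) (simp add: word_funpow_shift[of "Suc q" _ "q + n"])
  have inj: "inj_on (word (q + n)) E"
  proof (rule inj_onI)
    fix x y assume *: "x \<in> E" "y \<in> E" "word (q + n) x = word (q + n) y"
    have "word n z = take n (word (q + n) z)" for z :: "int \<Rightarrow> 'a"
      using word_funpow_shift[of n 0 "q + n" z] by simp
    then have "word n x = word n y" by (simp only: *(3))
    then show "x = y" using E(3) *(1,2) by (simp add: inj_on_def)
  qed
  have nonneg: "0 \<le> (\<Prod>i<n. \<pi> (take (Suc q) (drop i u)))" if "length u = q + n" for u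
  proof (intro prod_nonneg ballI less_imp_le assms(2))
    fix i assume "i \<in> {..<n}"
    then show "length (take (Suc q) (drop i u)) = Suc q" using that by simp
  qed
  have "(\<Sum>x\<in>E. a x) = (\<Sum>u\<in>word (q + n) ` E. \<Prod>i<n. \<pi> (take (Suc q) (drop i u)))"
    unfolding a_eq using inj by (simp add: sum.reindex)
  also have "\<dots> \<le> (\<Sum>u | length u = q + n. \<Prod>i<n. \<pi> (take (Suc q) (drop i u)))"
    by (intro sum_mono2) (auto intro: nonneg)
  also have "\<dots> = real (CARD('a) ^ q)" by (rule sum_markov_weights[OF assms(1)])
  finally have "(\<Sum>x\<in>E. a x) \<le> real (CARD('a) ^ q)" .
  moreover have "0 < a x" for x unfolding a_def by (intro prod_pos) (simp add: assms(2))
  ultimately have "ln (real (card E)) \<le> ln (real (CARD('a) ^ q)) - (\<Sum>x\<in>E. ln (a x)) / real (card E)"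
    using E(1,2) by (intro ln_card_le_gibbs) auto
  also have "ln (real (CARD('a) ^ q)) = real q * ln (real CARD('a))"
    by (simp add: ln_realpow)
  also have "(\<Sum>x\<in>E. ln (a x)) / real (card E)
      = - (real n * orbit_average E n (\<lambda>x. - ln (\<pi> (word (Suc q) x))))"
  proof -
    have "ln (a x) = (\<Sum>i<n. ln (\<pi> (word (Suc q) ((shift ^^ i) x))))" for x
      unfolding a_def using assms(2) by (intro ln_prod) (simp_all add: order_less_imp_not_eq2)
    then show ?thesis using n by (simp add: orbit_average_def sum_negf)
  qed
  finally show ?thesis using n by (simp add: field_simps)
qed

section \<open>The variational lower bound\<close>

lemma word_cylinder_snoc:
  "word_cylinder X (w @ [c]) = {x\<in>word_cylinder X w. x (int (length w)) = c}"
  by (auto simp: word_cylinder_def word_Suc)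

lemma word_cylinder_Cons:
  assumes "subshift X"
  shows "word_cylinder X (c # w) = {x\<in>X. x 0 = c \<and> shift x \<in> word_cylinder X w}"
  using assms by (auto simp: word_cylinder_def word_Suc_Cons subshift_def)

lemma word_cylinder_sets:
  fixes X :: "(int \<Rightarrow> 'a::{finite,discrete_topology}) set"
  assumes "sets \<nu> = sets (restrict_space borel X)"
  shows "word_cylinder X w \<in> sets \<nu>"
  unfolding assms sigma_sets_cylinder_algebra
  by (rule sigma_sets.Basic[OF word_cylinder_algebra])

lemma stationary_process_measure:
  fixes X :: "(int \<Rightarrow> 'a::{finite,discrete_topology}) set"
  assumes X: "subshift X" and \<nu>: "\<nu> \<in> invariant_measures X"
  shows "stationary_process (\<lambda>w. measure \<nu> (word_cylinder X w))"
proof -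
  interpret prob_space \<nu> using \<nu> by (simp add: invariant_measures_def)
  have sets: "sets \<nu> = sets (restrict_space borel X)" and inv: "distr \<nu> \<nu> shift = \<nu>"
    using \<nu> by (auto simp: invariant_measures_def)
  have space: "space \<nu> = X" by (rule space_subshift_measure[OF sets])
  note wc = word_cylinder_sets[OF sets]
  show ?thesis
  proof
    show "0 \<le> measure \<nu> (word_cylinder X w)" for w by simp
    have "word_cylinder X [] = space \<nu>" by (auto simp: word_cylinder_def word_def space)
    then show "measure \<nu> (word_cylinder X []) = 1" by (simp only: prob_space)
    fix w :: "'a list"
    have "measure \<nu> (\<Union>c. word_cylinder X (w @ [c])) = (\<Sum>c\<in>UNIV. measure \<nu> (word_cylinder X (w @ [c])))"
    proof (rule finite_measure_finite_Union)
      show "disjoint_family (\<lambda>c. word_cylinder X (w @ [c]))"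
        by (auto simp: disjoint_family_on_def word_cylinder_snoc)
    qed (use wc in auto)
    moreover have "(\<Union>c. word_cylinder X (w @ [c])) = word_cylinder X w"
      by (auto simp: word_cylinder_snoc)
    ultimately show "(\<Sum>c\<in>UNIV. measure \<nu> (word_cylinder X (w @ [c]))) = measure \<nu> (word_cylinder X w)"
      by simp
    have "measure \<nu> (\<Union>c. word_cylinder X (c # w)) = (\<Sum>c\<in>UNIV. measure \<nu> (word_cylinder X (c # w)))"
    proof (rule finite_measure_finite_Union)
      show "disjoint_family (\<lambda>c. word_cylinder X (c # w))"
        by (auto simp: disjoint_family_on_def word_cylinder_Cons[OF X])
    qed (use wc in auto)
    moreover have "(\<Union>c. word_cylinder X (c # w)) = shift -` word_cylinder X w \<inter> space \<nu>"
      by (auto simp: word_cylinder_Cons[OF X] space)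
    moreover have "measure \<nu> (shift -` word_cylinder X w \<inter> space \<nu>) = measure \<nu> (word_cylinder X w)"
      using measure_distr[OF measurable_shift[OF X sets] wc] by (simp add: inv)
    ultimately show "(\<Sum>c\<in>UNIV. measure \<nu> (word_cylinder X (c # w))) = measure \<nu> (word_cylinder X w)"
      by simp
  qed
qed

lemma word_cylinder_iff_letters:
  assumes "subshift X" "length w = n"
  shows "word_cylinder X w = {x\<in>X. \<forall>i<n. (shift ^^ i) x \<in> word_cylinder X [w ! i]}"
proof -
  have letter: "(shift ^^ i) x \<in> word_cylinder X [c] \<longleftrightarrow> x (int i) = c" if "x \<in> X" for x i c
    using funpow_shift_in[OF assms(1) that, of i]
    by (simp add: word_cylinder_def word_def funpow_shift_apply)
  have "word n x = w \<longleftrightarrow> (\<forall>i<n. x (int i) = w ! i)" for x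
    using assms(2) by (auto simp: list_eq_iff_nth_eq word_def)
  then have "word_cylinder X w = {x\<in>X. \<forall>i<n. x (int i) = w ! i}"
    using assms(2) by (simp add: word_cylinder_def)
  also have "\<dots> = {x\<in>X. \<forall>i<n. (shift ^^ i) x \<in> word_cylinder X [w ! i]}"
    by (intro Collect_cong conj_cong refl all_cong) (simp add: letter)
  finally show ?thesis .
qed

text \<open>
  The iterated joins of the partition by the symbol at the origin consist of the nonempty word
  cylinders; the empty ones contribute \<open>0 * ln 0 = 0\<close> to the block entropy.
\<close>

lemma ks_entropy_ge_rate:
  fixes X :: "(int \<Rightarrow> 'a::{finite,discrete_topology}) set"
  assumes X: "subshift X" and \<nu>: "\<nu> \<in> invariant_measures X"
  shows "ereal (lim (\<lambda>n. stationary_process.block_entropy (\<lambda>w. measure \<nu> (word_cylinder X w)) n / real n))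
      \<le> ks_entropy \<nu> shift"
proof -
  interpret P: stationary_process "\<lambda>w. measure \<nu> (word_cylinder X w)"
    by (rule stationary_process_measure[OF X \<nu>])
  have sets: "sets \<nu> = sets (restrict_space borel X)"
    using \<nu> by (auto simp: invariant_measures_def)
  have space: "space \<nu> = X" by (rule space_subshift_measure[OF sets])
  define \<P> where "\<P> = range (\<lambda>c. word_cylinder X [c]) - {{}}"
  have letter: "word_cylinder X [c] = {x\<in>X. x 0 = c}" for c
    by (auto simp: word_cylinder_def word_def)
  have "finite \<P>" "\<P> \<subseteq> sets \<nu>" unfolding \<P>_def using word_cylinder_sets[OF sets] by auto
  moreover have "partition_on (space \<nu>) \<P>"
    unfolding \<P>_def space letter by (auto simp: partition_on_def disjoint_def)
  moreover have "partition_entropy \<nu> (iterated_join \<nu> shift \<P> n) = P.block_entropy n" for n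
  proof -
    let ?W = "{w :: 'a list. length w = n}"
    have "iterated_join \<nu> shift \<P> n = word_cylinder X ` ?W - {{}}"
    proof (intro equalityI subsetI)
      fix S assume "S \<in> iterated_join \<nu> shift \<P> n"
      then obtain a where S: "S = {x\<in>X. \<forall>i<n. (shift ^^ i) x \<in> a i}" "S \<noteq> {}"
        and a: "\<And>i. i < n \<Longrightarrow> a i \<in> \<P>"
        by (auto simp: iterated_join_def space)
      from a have "\<forall>i<n. \<exists>c. a i = word_cylinder X [c]" unfolding \<P>_def by blast
      then obtain c where c: "\<And>i. i < n \<Longrightarrow> a i = word_cylinder X [c i]" by metis
      have "S = word_cylinder X (map c [0..<n])"
        unfolding word_cylinder_iff_letters[OF X, of "map c [0..<n]" n, simplified] S(1)
        by (intro Collect_cong conj_cong refl all_cong) (simp add: c)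
      then show "S \<in> word_cylinder X ` ?W - {{}}" using S(2) by auto
    next
      fix S assume "S \<in> word_cylinder X ` ?W - {{}}"
      then obtain w where w: "length w = n" "S = word_cylinder X w" "S \<noteq> {}" by auto
      have S: "S = {x\<in>X. \<forall>i<n. (shift ^^ i) x \<in> word_cylinder X [w ! i]}"
        unfolding w(2) by (rule word_cylinder_iff_letters[OF X w(1)])
      have "\<forall>i<n. word_cylinder X [w ! i] \<in> \<P>" unfolding \<P>_def using S w(3) by blast
      with S have "S \<in> {{x\<in>X. \<forall>i<n. (shift ^^ i) x \<in> a i} | a. \<forall>i<n. a i \<in> \<P>}"
        by (intro CollectI exI[of _ "\<lambda>i. word_cylinder X [w ! i]"] conjI)
      then show "S \<in> iterated_join \<nu> shift \<P> n"
        unfolding iterated_join_def space using w(3) by simp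
    qed
    then have "partition_entropy \<nu> (iterated_join \<nu> shift \<P> n)
        = - (\<Sum>A\<in>word_cylinder X ` ?W. measure \<nu> A * ln (measure \<nu> A))"
      unfolding partition_entropy_def by (simp, intro sum.mono_neutral_left) auto
    also have "(\<Sum>A\<in>word_cylinder X ` ?W. measure \<nu> A * ln (measure \<nu> A))
        = (\<Sum>w\<in>?W. measure \<nu> (word_cylinder X w) * ln (measure \<nu> (word_cylinder X w)))"
    proof (rule sum.reindex_nontrivial[unfolded o_def])
      fix v w assume "v \<in> ?W" "w \<in> ?W" "v \<noteq> w" "word_cylinder X v = word_cylinder X w"
      then have "word_cylinder X v = {}" by (auto simp: word_cylinder_def)
      then show "measure \<nu> (word_cylinder X v) * ln (measure \<nu> (word_cylinder X v)) = 0" by simp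
    qed simp
    finally show ?thesis by (simp add: P.block_entropy_def)
  qed
  then have "entropy_wrt_partition \<nu> shift \<P> = lim (\<lambda>n. P.block_entropy n / real n)"
    by (simp add: entropy_wrt_partition_def)
  ultimately show ?thesis
    unfolding ks_entropy_def by (intro SUP_upper2[of \<P>]) auto
qed

text \<open>
  In the limit the counting estimate becomes \<open>h \<le> - (\<Sum>u. p u * ln (\<pi> u))\<close> for every positive kernel
  \<open>\<pi>\<close>. The best choice is the conditional probability of the last symbol under \<open>\<nu>\<close>, for which the
  right-hand side is the increment of the block entropy. As this kernel may vanish, it is mixed with
  the uniform distribution in the proportion \<open>e\<close>, which changes the bound by at most
  \<open>- ln (1 - e)\<close>.
\<close>

lemma block_entropy_increment_ge:
  fixes X :: "(int \<Rightarrow> 'a::{finite,discrete_topology}) set"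
  assumes X: "subshift X" and \<nu>: "\<nu> \<in> invariant_measures X"
    and E: "\<And>k. finite (E k)" "\<And>k. E k \<noteq> {}" "\<And>k. E k \<subseteq> X" "\<And>k. inj_on (word (n k)) (E k)"
    and n: "filterlim n at_top sequentially"
    and lim: "\<And>C. C \<in> cylinder_algebra X \<Longrightarrow>
        (\<lambda>k. orbit_average (E k) (n k) (indicator C)) \<longlonglongrightarrow> measure \<nu> C"
    and h: "\<And>k. h \<le> ln (real (card (E k))) / real (n k)"
  shows "h \<le> stationary_process.block_entropy (\<lambda>w. measure \<nu> (word_cylinder X w)) (Suc q)
            - stationary_process.block_entropy (\<lambda>w. measure \<nu> (word_cylinder X w)) q"
proof -
  define p where "p w = measure \<nu> (word_cylinder X w)" for w
  interpret P: stationary_process p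
    unfolding p_def by (rule stationary_process_measure[OF X \<nu>])
  have cross: "h \<le> - (\<Sum>u | length u = Suc q. p u * ln (\<pi> u))"
    if \<pi>: "\<And>v. length v = q \<Longrightarrow> (\<Sum>c\<in>UNIV. \<pi> (v @ [c])) = 1" "\<And>u. length u = Suc q \<Longrightarrow> 0 < \<pi> u"
    for \<pi> :: "'a list \<Rightarrow> real"
  proof -
    define g where "g x = - ln (\<pi> (word (Suc q) x))" for x
    have g: "g x = (\<Sum>u | length u = Suc q. - ln (\<pi> u) * indicator (word_cylinder X u) x)"
      if "x \<in> X" for x
    proof -
      have "(\<Sum>u | length u = Suc q. - ln (\<pi> u) * indicator (word_cylinder X u) x)
          = (\<Sum>u\<in>{word (Suc q) x}. - ln (\<pi> u) * indicator (word_cylinder X u) x)"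
        by (rule sum.mono_neutral_right) (auto simp: word_cylinder_def indicator_def)
      then show ?thesis using that by (simp add: g_def word_cylinder_def)
    qed
    have "orbit_average (E k) (n k) g
        = (\<Sum>u | length u = Suc q. - ln (\<pi> u) * orbit_average (E k) (n k) (indicator (word_cylinder X u)))" for k
      unfolding orbit_average_cmult[symmetric] orbit_average_sum[symmetric]
      by (rule orbit_average_cong[OF X E(3) g])
    then have "(\<lambda>k. orbit_average (E k) (n k) g) \<longlonglongrightarrow> (\<Sum>u | length u = Suc q. - ln (\<pi> u) * p u)"
      unfolding p_def by (simp only:) (intro tendsto_sum tendsto_mult tendsto_const lim word_cylinder_algebra)
    moreover have "(\<lambda>k. real q * ln (real CARD('a)) / real (n k)) \<longlonglongrightarrow> 0"
      by (rule tendsto_divide_0[OF tendsto_const])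
        (rule filterlim_compose[OF filterlim_at_top_imp_at_infinity[OF filterlim_real_sequentially] n])
    ultimately have "(\<lambda>k. real q * ln (real CARD('a)) / real (n k) + orbit_average (E k) (n k) g)
        \<longlonglongrightarrow> 0 + (\<Sum>u | length u = Suc q. - ln (\<pi> u) * p u)"
      by (intro tendsto_add)
    moreover have "eventually (\<lambda>k. h \<le> real q * ln (real CARD('a)) / real (n k)
        + orbit_average (E k) (n k) g) sequentially"
      using eventually_compose_filterlim[OF eventually_gt_at_top[of 0] n]
    proof eventually_elim
      case (elim k)
      show ?case
        using order.trans[OF h ln_card_le_orbit_average[OF \<pi> E(1,2,4) elim]]
        by (simp add: g_def[abs_def])
    qed
    ultimately have "h \<le> 0 + (\<Sum>u | length u = Suc q. - ln (\<pi> u) * p u)"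
      by (intro tendsto_lowerbound) auto
    then show ?thesis by (simp add: sum_negf mult.commute)
  qed
  define d where "d = P.block_entropy (Suc q) - P.block_entropy q"
  have smooth: "h + ln (1 - e) \<le> d" if e: "0 < e" "e < 1" for e
  proof -
    \<comment> \<open>a word of probability zero has no conditional distribution; any positive one does\<close>
    define \<pi> where "\<pi> u = (if p (butlast u) = 0 then 1 / real CARD('a)
        else (1 - e) * p u / p (butlast u) + e / real CARD('a))" for u :: "'a list"
    have card: "0 < real CARD('a)" by simp
    have "h \<le> - (\<Sum>u | length u = Suc q. p u * ln (\<pi> u))"
    proof (rule cross)
      fix v :: "'a list"
      show "(\<Sum>c\<in>UNIV. \<pi> (v @ [c])) = 1"
      proof (cases "p v = 0")
        case False
        have "(\<Sum>c\<in>UNIV. \<pi> (v @ [c])) = (1 - e) * (\<Sum>c\<in>UNIV. p (v @ [c])) / p v + e"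
          using False by (simp add: \<pi>_def sum.distrib sum_divide_distrib sum_distrib_left)
        then show ?thesis using False by (simp add: P.extend_right)
      qed (simp add: \<pi>_def)
      show "0 < \<pi> u" for u
        using e card P.nonneg[of u] P.nonneg[of "butlast u"]
        by (auto simp: \<pi>_def intro!: add_nonneg_pos divide_nonneg_nonneg)
    qed
    also have "- (\<Sum>u | length u = Suc q. p u * ln (\<pi> u))
        \<le> (\<Sum>u | length u = Suc q. p u * (- ln (1 - e) - ln (p u) + ln (p (butlast u))))"
      unfolding sum_negf[symmetric]
    proof (rule sum_mono)
      fix u :: "'a list" assume "u \<in> {u. length u = Suc q}"
      then have u: "u = butlast u @ [last u]"
        by (metis append_butlast_last_id length_0_conv mem_Collect_eq nat.distinct(1))
      show "- (p u * ln (\<pi> u)) \<le> p u * (- ln (1 - e) - ln (p u) + ln (p (butlast u)))"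
      proof (cases "p u = 0")
        case False
        then have pu: "0 < p u" using P.nonneg[of u] by simp
        have pb: "0 < p (butlast u)" using pu P.snoc_le[of "butlast u" "last u"] u by simp
        have "(1 - e) * p u / p (butlast u) \<le> \<pi> u"
          using pb e by (simp add: \<pi>_def)
        then have "ln ((1 - e) * p u / p (butlast u)) \<le> ln (\<pi> u)"
          using pu pb e by (intro ln_mono) auto
        then have "ln (1 - e) + ln (p u) - ln (p (butlast u)) \<le> ln (\<pi> u)"
          using pu pb e by (simp add: ln_mult ln_div)
        then have "p u * (ln (1 - e) + ln (p u) - ln (p (butlast u))) \<le> p u * ln (\<pi> u)"
          using pu by (intro mult_left_mono) auto
        then show ?thesis by (simp add: algebra_simps)
      qed simp
    qed
    also have "\<dots> = - ln (1 - e) * (\<Sum>u | length u = Suc q. p u) - (\<Sum>u | length u = Suc q. p u * ln (p u))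
        + (\<Sum>u | length u = Suc q. p u * ln (p (butlast u)))"
      by (simp add: algebra_simps sum.distrib sum_subtractf sum_distrib_left sum_negf)
    also have "(\<Sum>u | length u = Suc q. p u * ln (p (butlast u))) = - P.block_entropy q"
      by (simp add: P.block_entropy_def sum_words_snoc sum_distrib_right[symmetric] P.extend_right)
    finally show ?thesis by (simp add: d_def P.block_entropy_def P.sum_eq_1)
  qed
  have "h \<le> d"
  proof (rule ccontr)
    assume "\<not> h \<le> d"
    \<comment> \<open>\<open>e\<close> is chosen with \<open>ln (1 - e) = - (h - d) / 2\<close>\<close>
    then have "0 < (h - d) / 2" by simp
    then have "h + ln (1 - (1 - exp (- ((h - d) / 2)))) \<le> d"
      by (intro smooth) auto
    then show False using \<open>\<not> h \<le> d\<close> by (simp add: field_simps)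
  qed
  then show ?thesis unfolding d_def p_def .
qed

text \<open>
  Up to \<open>e / 2\<close> the potential is a function of the coordinates in a finite window. The orbit averages
  of such a function are finite sums of frequencies of cylinder sets, so they converge.
\<close>

lemma integral_ge_of_orbit_averages:
  fixes X :: "(int \<Rightarrow> 'a::{finite,discrete_topology}) set"
  assumes X: "subshift X" and \<nu>: "\<nu> \<in> invariant_measures X"
    and E: "\<And>k. finite (E k)" "\<And>k. E k \<noteq> {}" "\<And>k. E k \<subseteq> X"
    and n: "filterlim n at_top sequentially"
    and lim: "\<And>C. C \<in> cylinder_algebra X \<Longrightarrow>
        (\<lambda>k. orbit_average (E k) (n k) (indicator C)) \<longlonglongrightarrow> measure \<nu> C"
    and int: "integrable \<nu> \<phi>"
    and unif: "\<And>e. 0 < e \<Longrightarrow> \<exists>N. \<forall>x\<in>X. \<forall>y\<in>X. agree N x y \<longrightarrow> \<bar>\<phi> x - \<phi> y\<bar> \<le> e"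
    and b: "\<And>k. b \<le> orbit_average (E k) (n k) \<phi>"
  shows "b \<le> integral\<^sup>L \<nu> \<phi>"
proof (rule field_le_epsilon)
  fix e :: real assume "0 < e"
  then obtain N where N: "\<And>x y. x \<in> X \<Longrightarrow> y \<in> X \<Longrightarrow> agree N x y \<Longrightarrow> \<bar>\<phi> x - \<phi> y\<bar> \<le> e / 2"
    using unif[of "e / 2"] by auto
  interpret prob_space \<nu> using \<nu> by (simp add: invariant_measures_def)
  have sets: "sets \<nu> = sets (restrict_space borel X)" using \<nu> by (simp add: invariant_measures_def)
  have space: "space \<nu> = X" by (rule space_subshift_measure[OF sets])
  define R where "R x = {y\<in>X. agree N x y}" for x
  \<comment> \<open>the value of \<open>\<phi>\<close> at a representative of the points that agree with \<open>x\<close> on the window\<close>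
  define g where "g x = \<phi> (SOME y. y \<in> R x)" for x
  have R_sat: "saturated X N (R x)" for x
    unfolding R_def saturated_def by (auto intro: agree_trans)
  have R_eq: "R x = R y" if "agree N x y" for x y
    using that unfolding R_def by (auto intro: agree_trans agree_sym)
  have g_close: "\<bar>\<phi> x - g x\<bar> \<le> e / 2" if "x \<in> X" for x
  proof -
    have "x \<in> R x" using that by (simp add: R_def)
    then have "(SOME y. y \<in> R x) \<in> R x" by (rule someI[of "\<lambda>y. y \<in> R x"])
    then show ?thesis unfolding g_def using N[OF that] by (simp add: R_def)
  qed
  define V where "V = g ` X"
  have "V \<subseteq> (\<lambda>C. \<phi> (SOME y. y \<in> C)) ` {C. saturated X N C}"
    unfolding V_def g_def using R_sat by auto
  then have V: "finite V" by (rule finite_subset) (simp add: finite_saturated)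
  define L where "L v = {x\<in>X. g x = v}" for v
  have "g x = g y" if "agree N x y" for x y
    using R_eq[OF that] by (simp add: g_def)
  then have "saturated X N (L v)" for v
    unfolding L_def saturated_def by auto
  then have L: "L v \<in> cylinder_algebra X" for v by (rule cylinder_algebraI)
  have L_sets: "L v \<in> sets \<nu>" for v
    unfolding sets sigma_sets_cylinder_algebra by (rule sigma_sets.Basic[OF L])
  have g_sum: "g x = (\<Sum>v\<in>V. v * indicator (L v) x)" if "x \<in> X" for x
  proof -
    have "(\<Sum>v\<in>V. v * indicator (L v) x) = (\<Sum>v\<in>{g x}. v * indicator (L v) x)"
      using that V by (intro sum.mono_neutral_right) (auto simp: V_def L_def indicator_def)
    then show ?thesis using that by (simp add: L_def)
  qed
  have "orbit_average (E k) (n k) g = (\<Sum>v\<in>V. v * orbit_average (E k) (n k) (indicator (L v)))" for k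
    unfolding orbit_average_cmult[symmetric] orbit_average_sum[symmetric]
    by (rule orbit_average_cong[OF X E(3) g_sum])
  then have "(\<lambda>k. orbit_average (E k) (n k) g) \<longlonglongrightarrow> (\<Sum>v\<in>V. v * measure \<nu> (L v))"
    by (simp only:) (intro tendsto_sum tendsto_mult tendsto_const lim L)
  moreover have "eventually (\<lambda>k. b - e / 2 \<le> orbit_average (E k) (n k) g) sequentially"
    using eventually_compose_filterlim[OF eventually_gt_at_top[of 0] n]
  proof eventually_elim
    case (elim k)
    have "orbit_average (E k) (n k) \<phi> \<le> orbit_average (E k) (n k) (\<lambda>x. g x + e / 2)"
    proof (rule orbit_average_mono[OF X E(3)])
      show "\<phi> x \<le> g x + e / 2" if "x \<in> X" for x using g_close[OF that] by linarith
    qed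
    also have "\<dots> = orbit_average (E k) (n k) g + e / 2"
      unfolding orbit_average_add by (simp add: orbit_average_const E elim)
    finally show ?case using b[of k] by simp
  qed
  ultimately have "b - e / 2 \<le> (\<Sum>v\<in>V. v * measure \<nu> (L v))"
    by (intro tendsto_lowerbound) auto
  also have "\<dots> = (\<integral>x. (\<Sum>v\<in>V. v * indicator (L v) x) \<partial>\<nu>)"
    using L_sets by (subst Bochner_Integration.integral_sum) (auto simp: emeasure_eq_measure)
  also have "\<dots> \<le> (\<integral>x. \<phi> x + e / 2 \<partial>\<nu>)"
  proof (rule integral_mono)
    show "integrable \<nu> (\<lambda>x. \<Sum>v\<in>V. v * indicator (L v) x)"
      using L_sets by (intro Bochner_Integration.integrable_sum) (auto simp: emeasure_eq_measure)
    show "integrable \<nu> (\<lambda>x. \<phi> x + e / 2)" using int by simp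
    fix x assume "x \<in> space \<nu>"
    then have "x \<in> X" by (simp add: space)
    then show "(\<Sum>v\<in>V. v * indicator (L v) x) \<le> \<phi> x + e / 2"
      using g_close[of x] g_sum[of x] by linarith
  qed
  also have "\<dots> = integral\<^sup>L \<nu> \<phi> + e / 2" using int by (simp add: prob_space)
  finally show "b \<le> integral\<^sup>L \<nu> \<phi> + e" by simp
qed

lemma potential_bounded:
  fixes X :: "(int \<Rightarrow> 'a::{finite,discrete_topology}) set"
  assumes "subshift X" "continuous_on X \<phi>"
  obtains B :: real where "\<And>x. x \<in> X \<Longrightarrow> \<bar>\<phi> x\<bar> \<le> B"
proof -
  have "compact X" using assms(1) compact_Int_closed[OF compact_full_shift, of X] by (simp add: subshift_def)
  with assms(2) have "compact (\<phi> ` X)" by (rule compact_continuous_image)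
  then have "bounded (\<phi> ` X)" by (rule compact_imp_bounded)
  then obtain B where "\<forall>y\<in>\<phi> ` X. norm y \<le> B" unfolding bounded_iff by (elim exE)
  then have "\<bar>\<phi> x\<bar> \<le> B" if "x \<in> X" for x using that by simp
  then show ?thesis by (rule that)
qed

lemma potential_integrable:
  fixes X :: "(int \<Rightarrow> 'a::{finite,discrete_topology}) set"
  assumes "subshift X" "continuous_on X \<phi>" "\<nu> \<in> invariant_measures X"
  shows "integrable \<nu> (\<phi> :: _ \<Rightarrow> real)"
proof -
  interpret prob_space \<nu> using assms(3) by (simp add: invariant_measures_def)
  have sets: "sets \<nu> = sets (restrict_space borel X)" using assms(3) by (simp add: invariant_measures_def)
  obtain B where B: "\<And>x. x \<in> X \<Longrightarrow> \<bar>\<phi> x\<bar> \<le> B"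
    using potential_bounded[OF assms(1,2)] by metis
  show ?thesis
  proof (rule integrable_const_bound)
    show "AE x in \<nu>. norm (\<phi> x) \<le> B"
      using B by (intro AE_I2) (simp add: space_subshift_measure[OF sets])
    show "\<phi> \<in> borel_measurable \<nu>"
      using borel_measurable_continuous_on_restrict[OF assms(2)]
      by (simp add: measurable_cong_sets[OF sets refl])
  qed
qed

text \<open>
  The half of the variational principle that constructs measures: sets of orbit segments with
  exponentially many different words turn into entropy, and lower bounds for orbit averages pass to
  the integral.
\<close>

theorem variational_lower_bound:
  fixes X :: "(int \<Rightarrow> 'a::{finite,discrete_topology}) set"
  assumes X: "subshift X" and \<phi>: "continuous_on X \<phi>"
    and E: "\<And>k. finite (E k)" "\<And>k. E k \<noteq> {}" "\<And>k. E k \<subseteq> X" "\<And>k. inj_on (word (n k)) (E k)"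
    and n: "filterlim n at_top sequentially"
    and unif: "\<And>e. 0 < e \<Longrightarrow> \<exists>N. \<forall>x\<in>X. \<forall>y\<in>X. agree N x y \<longrightarrow> \<bar>\<phi> x - \<phi> y\<bar> \<le> e"
    and h: "\<And>k. h \<le> ln (real (card (E k))) / real (n k)"
    and b: "\<And>k. b \<le> orbit_average (E k) (n k) \<phi>"
  obtains \<nu> where "\<nu> \<in> invariant_measures X" "ereal (h + b) \<le> free_energy \<phi> \<nu>"
proof -
  obtain \<nu> r where \<nu>: "\<nu> \<in> invariant_measures X" and r: "strict_mono r"
    and lim: "\<And>C. C \<in> cylinder_algebra X \<Longrightarrow>
       (\<lambda>k. orbit_average (E (r k)) (n (r k)) (indicator C)) \<longlonglongrightarrow> measure \<nu> C"
    using orbit_average_limit[where E = E and n = n, OF X E(1-3) n] by metis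
  have nr: "filterlim (\<lambda>k. n (r k)) at_top sequentially"
    using filterlim_compose[OF n filterlim_subseq[OF r]] .
  interpret P: stationary_process "\<lambda>w. measure \<nu> (word_cylinder X w)"
    by (rule stationary_process_measure[OF X \<nu>])
  have "h \<le> lim (\<lambda>q. P.block_entropy q / real q)"
    by (rule P.block_entropy_rate_ge, 
      rule block_entropy_increment_ge[where E = "\<lambda>k. E (r k)" and n = "\<lambda>k. n (r k)", OF X \<nu> E nr lim h])
  then have "ereal h \<le> ereal (lim (\<lambda>q. P.block_entropy q / real q))" by simp
  also have "\<dots> \<le> ks_entropy \<nu> shift" by (rule ks_entropy_ge_rate[OF X \<nu>])
  finally have "ereal h \<le> ks_entropy \<nu> shift" .
  moreover have "b \<le> integral\<^sup>L \<nu> \<phi>"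
    by (rule integral_ge_of_orbit_averages
        [where E = "\<lambda>k. E (r k)" and n = "\<lambda>k. n (r k)",
          OF X \<nu> E(1-3) nr lim potential_integrable[OF X \<phi> \<nu>] unif b])
  ultimately have "ereal h + ereal b \<le> free_energy \<phi> \<nu>"
    unfolding free_energy_def by (intro add_mono) auto
  then show ?thesis using that[OF \<nu>] by simp
qed

section \<open>Birkhoff sums of Hoelder potentials\<close>

definition birkhoff_sum :: "((int \<Rightarrow> 'a) \<Rightarrow> real) \<Rightarrow> nat \<Rightarrow> (int \<Rightarrow> 'a) \<Rightarrow> real" where
  "birkhoff_sum \<phi> n x = (\<Sum>p<n. \<phi> ((shift ^^ p) x))"

lemma birkhoff_sum_add:
  "birkhoff_sum \<phi> (m + n) x = birkhoff_sum \<phi> m x + birkhoff_sum \<phi> n ((shift ^^ m) x)"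
proof -
  have "birkhoff_sum \<phi> (m + n) x = (\<Sum>p<m. \<phi> ((shift ^^ p) x)) + (\<Sum>p=m..<m+n. \<phi> ((shift ^^ p) x))"
    unfolding birkhoff_sum_def by (simp add: lessThan_atLeast0 sum.atLeastLessThan_concat)
  also have "(\<Sum>p=m..<m+n. \<phi> ((shift ^^ p) x)) = (\<Sum>p<n. \<phi> ((shift ^^ (p + m)) x))"
    using sum.shift_bounds_nat_ivl[of "\<lambda>p. \<phi> ((shift ^^ p) x)" 0 m n]
    by (simp add: lessThan_atLeast0 add.commute)
  finally show ?thesis by (simp add: birkhoff_sum_def funpow_add)
qed

lemma birkhoff_sum_abs_le:
  assumes "subshift X" "\<And>x. x \<in> X \<Longrightarrow> \<bar>\<phi> x\<bar> \<le> B" "x \<in> X"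
  shows "\<bar>birkhoff_sum \<phi> n x\<bar> \<le> real n * B"
proof -
  have "\<bar>birkhoff_sum \<phi> n x\<bar> \<le> (\<Sum>p<n. B)"
    unfolding birkhoff_sum_def
    by (rule order.trans[OF sum_abs sum_mono]) (intro assms(2) funpow_shift_in assms(1,3))
  then show ?thesis by simp
qed

lemma holder_on_agree:
  assumes "holder_on X \<phi>"
  obtains C t where "0 \<le> C" "0 < t" "t < 1"
    "\<And>x y N. x \<in> X \<Longrightarrow> y \<in> X \<Longrightarrow> agree N x y \<Longrightarrow> \<bar>\<phi> x - \<phi> y\<bar> \<le> C * t ^ N"
proof -
  obtain C \<alpha> where \<alpha>: "\<alpha> > 0"
    and C: "\<And>x y. x \<in> X \<Longrightarrow> y \<in> X \<Longrightarrow> \<bar>\<phi> x - \<phi> y\<bar> \<le> C * shift_dist x y powr \<alpha>"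
    using assms unfolding holder_on_def by blast
  define t :: real where "t = (1 / 2) powr \<alpha>"
  have t: "0 < t" "t < 1" using \<alpha> by (auto simp: t_def powr_def ln_div)
  have "\<bar>\<phi> x - \<phi> y\<bar> \<le> \<bar>C\<bar> * t ^ N" if "x \<in> X" "y \<in> X" "agree N x y" for x y N
  proof -
    have "shift_dist x y \<le> (1 / 2) ^ N"
      using shift_dist_agree[OF that(3)] shift_dist_nonneg[of x y] by simp
    then have "shift_dist x y powr \<alpha> \<le> ((1 / 2) ^ N) powr \<alpha>"
      using \<alpha> by (intro powr_mono2 shift_dist_nonneg) auto
    also have "\<dots> = t ^ N"
      by (simp add: t_def powr_realpow[symmetric] powr_powr mult.commute)
    finally have "\<bar>C\<bar> * shift_dist x y powr \<alpha> \<le> \<bar>C\<bar> * t ^ N"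
      by (intro mult_left_mono) auto
    moreover have "C * shift_dist x y powr \<alpha> \<le> \<bar>C\<bar> * shift_dist x y powr \<alpha>"
      by (intro mult_right_mono) auto
    ultimately show ?thesis using C[OF that(1,2)] by linarith
  qed
  then show ?thesis by (rule that[OF abs_ge_zero t])
qed

lemma holder_uniform:
  assumes "holder_on X \<phi>" "0 < e"
  shows "\<exists>N. \<forall>x\<in>X. \<forall>y\<in>X. agree N x y \<longrightarrow> \<bar>\<phi> x - \<phi> y\<bar> \<le> e"
proof -
  obtain C t where Ct: "0 \<le> C" "0 < t" "t < 1"
    "\<And>x y N. x \<in> X \<Longrightarrow> y \<in> X \<Longrightarrow> agree N x y \<Longrightarrow> \<bar>\<phi> x - \<phi> y\<bar> \<le> C * t ^ N"
    by (rule holder_on_agree[OF assms(1)]) blast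
  have "(\<lambda>N. C * t ^ N) \<longlonglongrightarrow> C * 0"
    using Ct by (intro tendsto_mult tendsto_const LIMSEQ_power_zero) auto
  then have "eventually (\<lambda>N. C * t ^ N < e) sequentially"
    using assms(2) by (intro order_tendstoD(2)) auto
  then obtain N where "C * t ^ N < e" unfolding eventually_sequentially by blast
  then show ?thesis using Ct(4) by (meson less_imp_le order.trans)
qed

text \<open>
  Position \<open>p\<close> of a common word of length \<open>n\<close> has distance \<open>min p (n - 1 - p)\<close> to the ends of the word,
  so the differences of the values of \<open>\<phi>\<close> are bounded by two geometric series.
\<close>

lemma holder_distortion:
  assumes "subshift X" "holder_on X \<phi>"
  obtains K where "0 \<le> K"
    "\<And>x y n. x \<in> X \<Longrightarrow> y \<in> X \<Longrightarrow> (\<And>i. i < n \<Longrightarrow> x (int i) = y (int i)) \<Longrightarrow>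
       \<bar>birkhoff_sum \<phi> n x - birkhoff_sum \<phi> n y\<bar> \<le> K"
proof -
  obtain C t where Ct: "0 \<le> C" "0 < t" "t < 1"
    "\<And>x y N. x \<in> X \<Longrightarrow> y \<in> X \<Longrightarrow> agree N x y \<Longrightarrow> \<bar>\<phi> x - \<phi> y\<bar> \<le> C * t ^ N"
    by (rule holder_on_agree[OF assms(2)]) blast
  have geo: "(\<Sum>p<n. t ^ p) \<le> 1 / (1 - t)" for n
    using Ct by (simp add: sum_gp_strict divide_right_mono)
  have "\<bar>birkhoff_sum \<phi> n x - birkhoff_sum \<phi> n y\<bar> \<le> C * (2 / (1 - t))"
    if xy: "x \<in> X" "y \<in> X" and eq: "\<And>i. i < n \<Longrightarrow> x (int i) = y (int i)" for x y n
  proof -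
    have "\<bar>birkhoff_sum \<phi> n x - birkhoff_sum \<phi> n y\<bar>
        \<le> (\<Sum>p<n. C * (t ^ p + t ^ (n - Suc p)))"
      unfolding birkhoff_sum_def sum_subtractf[symmetric]
    proof (rule order.trans[OF sum_abs sum_mono])
      fix p assume "p \<in> {..<n}"
      then have p: "p < n" by simp
      define N where "N = min p (n - Suc p)"
      have "agree N ((shift ^^ p) x) ((shift ^^ p) y)"
        unfolding agree_def funpow_shift_apply
      proof (intro allI impI)
        fix i :: int assume "\<bar>i\<bar> \<le> int N"
        then have "0 \<le> i + int p" "nat (i + int p) < n" using p by (auto simp: N_def)
        then show "x (i + int p) = y (i + int p)" using eq[of "nat (i + int p)"] by simp
      qed
      then have "\<bar>\<phi> ((shift ^^ p) x) - \<phi> ((shift ^^ p) y)\<bar> \<le> C * t ^ N"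
        by (intro Ct(4) funpow_shift_in[OF assms(1)] xy)
      also have "\<dots> \<le> C * (t ^ p + t ^ (n - Suc p))"
        using Ct by (intro mult_left_mono) (auto simp: N_def min_def)
      finally show "\<bar>\<phi> ((shift ^^ p) x) - \<phi> ((shift ^^ p) y)\<bar> \<le> C * (t ^ p + t ^ (n - Suc p))" .
    qed
    also have "\<dots> = C * ((\<Sum>p<n. t ^ p) + (\<Sum>p<n. t ^ p))"
      unfolding sum_distrib_left[symmetric] sum.distrib sum.nat_diff_reindex ..
    also have "\<dots> \<le> C * (2 / (1 - t))"
      using geo[of n] Ct(1) by (intro mult_left_mono) auto
    finally show ?thesis .
  qed
  moreover have "0 \<le> C * (2 / (1 - t))" using Ct by simp
  ultimately show ?thesis using that by blast
qed

lemma integral_shift: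
  fixes X :: "(int \<Rightarrow> 'a::{finite,discrete_topology}) set"
  assumes "subshift X" "\<mu> \<in> invariant_measures X" "integrable \<mu> (g :: _ \<Rightarrow> real)"
  shows "integrable \<mu> (\<lambda>x. g (shift x)) \<and> (\<integral>x. g (shift x) \<partial>\<mu>) = integral\<^sup>L \<mu> g"
proof -
  have sets: "sets \<mu> = sets (restrict_space borel X)" and inv: "distr \<mu> \<mu> shift = \<mu>"
    using assms(2) by (auto simp: invariant_measures_def)
  note meas = measurable_shift[OF assms(1) sets]
  have g: "g \<in> borel_measurable \<mu>" using assms(3) by (rule borel_measurable_integrable)
  show ?thesis
    using integrable_distr_eq[OF meas g] integral_distr[OF meas g] assms(3) by (simp add: inv)
qed

lemma exists_birkhoff_sum_ge:
  fixes X :: "(int \<Rightarrow> 'a::{finite,discrete_topology}) set"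
  assumes X: "subshift X" and \<phi>: "continuous_on X \<phi>" and \<mu>: "\<mu> \<in> invariant_measures X"
  obtains x where "x \<in> X" "real n * integral\<^sup>L \<mu> \<phi> \<le> birkhoff_sum \<phi> n x"
proof -
  interpret prob_space \<mu> using \<mu> by (simp add: invariant_measures_def)
  have sets: "sets \<mu> = sets (restrict_space borel X)" using \<mu> by (simp add: invariant_measures_def)
  have int: "integrable \<mu> (\<lambda>x. \<phi> ((shift ^^ p) x)) \<and>
      (\<integral>x. \<phi> ((shift ^^ p) x) \<partial>\<mu>) = integral\<^sup>L \<mu> \<phi>" for p
  proof (induction p)
    case 0
    show ?case using potential_integrable[OF X \<phi> \<mu>] by simp
  next
    case (Suc p)
    show ?case
      using integral_shift[OF X \<mu>, of "\<lambda>x. \<phi> ((shift ^^ p) x)"] Suc.IH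
      by (simp add: funpow_Suc_right del: funpow.simps)
  qed
  have "\<exists>x\<in>X. real n * integral\<^sup>L \<mu> \<phi> \<le> birkhoff_sum \<phi> n x"
  proof (rule ccontr)
    assume "\<not> ?thesis"
    then have "AE x in \<mu>. birkhoff_sum \<phi> n x < real n * integral\<^sup>L \<mu> \<phi>"
      by (intro AE_I2) (auto simp: space_subshift_measure[OF sets] not_le)
    moreover have "integrable \<mu> (birkhoff_sum \<phi> n)"
      unfolding birkhoff_sum_def using int by (intro Bochner_Integration.integrable_sum) blast
    ultimately have "integral\<^sup>L \<mu> (birkhoff_sum \<phi> n) < real n * integral\<^sup>L \<mu> \<phi>"
      by (intro expectation_less)
    moreover have "integral\<^sup>L \<mu> (birkhoff_sum \<phi> n) = real n * integral\<^sup>L \<mu> \<phi>"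
      unfolding birkhoff_sum_def using int by (subst Bochner_Integration.integral_sum) auto
    ultimately show False by simp
  qed
  then show ?thesis using that by blast
qed

section \<open>Entropy from patterns of orbit segments\<close>

text \<open>
  A pattern is a list of orbit segments, each given by a point and a length. After every segment,
  also after the last one, \<open>g\<close> symbols are left free, so that patterns can be concatenated.
\<close>

fun follows :: "nat \<Rightarrow> (int \<Rightarrow> 'a) \<Rightarrow> ((int \<Rightarrow> 'a) \<times> nat) list \<Rightarrow> bool" where
  "follows g z [] \<longleftrightarrow> True"
| "follows g z ((x, n) # L) \<longleftrightarrow>
     (\<forall>j<n. z (int j) = x (int j)) \<and> follows g ((shift ^^ (n + g)) z) L"

definition pattern_length :: "nat \<Rightarrow> ((int \<Rightarrow> 'a) \<times> nat) list \<Rightarrow> nat" where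
  "pattern_length g L = (\<Sum>(x, n)\<leftarrow>L. n + g)"

text \<open>
  A lower bound for the Birkhoff sum of any point that follows the pattern, when \<open>c\<close> pays for the
  distortion along a segment and for the gap behind it.
\<close>

definition pattern_value ::
    "((int \<Rightarrow> 'a) \<Rightarrow> real) \<Rightarrow> real \<Rightarrow> ((int \<Rightarrow> 'a) \<times> nat) list \<Rightarrow> real" where
  "pattern_value \<phi> c L = (\<Sum>(x, n)\<leftarrow>L. birkhoff_sum \<phi> n x - c)"

lemma pattern_length_simps [simp]:
  "pattern_length g [] = 0" "pattern_length g ((x, n) # L) = n + g + pattern_length g L"
  "pattern_length g (L @ L') = pattern_length g L + pattern_length g L'"
  by (simp_all add: pattern_length_def)

lemma pattern_value_simps [simp]:
  "pattern_value \<phi> c [] = 0"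
  "pattern_value \<phi> c ((x, n) # L) = birkhoff_sum \<phi> n x - c + pattern_value \<phi> c L"
  "pattern_value \<phi> c (L @ L') = pattern_value \<phi> c L + pattern_value \<phi> c L'"
  by (simp_all add: pattern_value_def)

lemma follows_append:
  "follows g z (L @ L') \<longleftrightarrow> follows g z L \<and> follows g ((shift ^^ pattern_length g L) z) L'"
  by (induction g z L rule: follows.induct)
    (simp_all add: conj_assoc funpow_add[symmetric, unfolded fun_eq_iff o_def, rule_format] add_ac)

lemma followsI:
  assumes "\<And>i j. i < length L \<Longrightarrow> j < snd (L ! i) \<Longrightarrow>
      z (int (j + (\<Sum>l<i. snd (L ! l) + g))) = fst (L ! i) (int j)"
  shows "follows g z L"
  using assms
proof (induction g z L rule: follows.induct)
  case (2 g z x n L)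
  have "z (int j) = x (int j)" if "j < n" for j
    using 2(2)[of 0 j] that by simp
  moreover have "follows g ((shift ^^ (n + g)) z) L"
  proof (rule 2(1))
    fix i j assume "i < length L" "j < snd (L ! i)"
    then show "(shift ^^ (n + g)) z (int (j + (\<Sum>l<i. snd (L ! l) + g))) = fst (L ! i) (int j)"
      using 2(2)[of "Suc i" j] by (simp add: funpow_shift_apply sum.lessThan_Suc_shift add_ac del: sum.lessThan_Suc)
  qed
  ultimately show ?case by simp
qed simp

lemma glues_follows:
  assumes "glues X f" "L \<noteq> []" "\<And>x n. (x, n) \<in> set L \<Longrightarrow> x \<in> X \<and> 0 < n \<and> f n \<le> g"
  obtains z where "z \<in> X" "follows g z L"
proof -
  have L: "fst (L ! i) \<in> X" "0 < snd (L ! i)" "f (snd (L ! i)) \<le> g" if "i < length L" for i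
    using assms(3)[of "fst (L ! i)" "snd (L ! i)"] nth_mem[OF that] by auto
  obtain z where z: "z \<in> X" "\<And>i m. i \<in> {1..length L} \<Longrightarrow> m < snd (L ! (i - 1)) \<Longrightarrow>
      z (int (m + (\<Sum>j=1..<i. snd (L ! (j - 1)) + g))) = fst (L ! (i - 1)) (int m)"
  proof (rule gluesD[OF assms(1), of "length L" "\<lambda>i. fst (L ! (i - 1))" "\<lambda>i. snd (L ! (i - 1))" "\<lambda>_. g"])
    show "1 \<le> length L" using assms(2) by (simp add: Suc_le_eq)
  qed (auto intro!: L)
  have "follows g z L"
  proof (rule followsI)
    fix i j assume ij: "i < length L" "j < snd (L ! i)"
    have "(\<Sum>l=1..<Suc i. snd (L ! (l - 1)) + g) = (\<Sum>l<i. snd (L ! l) + g)"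
      by (simp only: One_nat_def sum.shift_bounds_Suc_ivl lessThan_atLeast0 diff_Suc_Suc diff_zero)
    then show "z (int (j + (\<Sum>l<i. snd (L ! l) + g))) = fst (L ! i) (int j)"
      using z(2)[of "Suc i" j] ij by simp
  qed
  then show ?thesis using z(1) that by blast
qed

lemma birkhoff_sum_follows:
  assumes X: "subshift X" and B: "\<And>x. x \<in> X \<Longrightarrow> \<bar>\<phi> x\<bar> \<le> B"
    and K: "\<And>x y n. x \<in> X \<Longrightarrow> y \<in> X \<Longrightarrow> (\<And>i. i < n \<Longrightarrow> x (int i) = y (int i)) \<Longrightarrow>
       \<bar>birkhoff_sum \<phi> n x - birkhoff_sum \<phi> n y\<bar> \<le> K"
    and "z \<in> X" "\<And>x n. (x, n) \<in> set L \<Longrightarrow> x \<in> X" "follows g z L"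
  shows "pattern_value \<phi> (K + real g * B) L \<le> birkhoff_sum \<phi> (pattern_length g L) z"
  using assms(4-6)
proof (induction L arbitrary: z)
  case (Cons s L)
  obtain x n where s: "s = (x, n)" by fastforce
  have "\<bar>birkhoff_sum \<phi> n z - birkhoff_sum \<phi> n x\<bar> \<le> K"
    using Cons.prems s by (intro K) auto
  moreover have "\<bar>birkhoff_sum \<phi> g ((shift ^^ n) z)\<bar> \<le> real g * B"
    using Cons.prems by (intro birkhoff_sum_abs_le[OF X B] funpow_shift_in[OF X]) auto
  moreover have "pattern_value \<phi> (K + real g * B) L
      \<le> birkhoff_sum \<phi> (pattern_length g L) ((shift ^^ (n + g)) z)"
    using Cons.prems s by (intro Cons.IH funpow_shift_in[OF X]) auto
  moreover have "birkhoff_sum \<phi> (pattern_length g (s # L)) z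
      = birkhoff_sum \<phi> n z + birkhoff_sum \<phi> g ((shift ^^ n) z)
        + birkhoff_sum \<phi> (pattern_length g L) ((shift ^^ (n + g)) z)"
    by (simp add: s birkhoff_sum_add)
  ultimately show ?case by (simp add: s)
qed (simp add: birkhoff_sum_def)

lemma follows_concat:
  assumes "\<And>a. a \<in> set cs \<Longrightarrow> pattern_length g (pat a) = P" "follows g z (concat (map pat cs))"
    and "i < length cs"
  shows "follows g ((shift ^^ (i * P)) z) (pat (cs ! i))"
  using assms
proof (induction cs arbitrary: z i)
  case (Cons a cs)
  show ?case
  proof (cases i)
    case 0
    then show ?thesis using Cons.prems(2) by (simp add: follows_append)
  next
    case (Suc i')
    have "follows g ((shift ^^ P) z) (concat (map pat cs))"
      using Cons.prems(1,2) by (simp add: follows_append)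
    then have "follows g ((shift ^^ (i' * P)) ((shift ^^ P) z)) (pat (cs ! i'))"
      using Cons.prems(1,3) Suc by (intro Cons.IH) auto
    then show ?thesis by (simp add: Suc funpow_add add.commute[of P])
  qed
qed simp

lemma pattern_length_concat:
  assumes "\<And>a. a \<in> set cs \<Longrightarrow> pattern_length g (pat a) = P"
  shows "pattern_length g (concat (map pat cs)) = length cs * P"
  using assms by (induction cs) simp_all

lemma pattern_value_concat:
  assumes "\<And>a. a \<in> set cs \<Longrightarrow> v \<le> pattern_value \<phi> c (pat a)"
  shows "real (length cs) * v \<le> pattern_value \<phi> c (concat (map pat cs))"
  using assms by (induction cs) (force simp: algebra_simps)+

text \<open>
  All concatenations of \<open>k + 1\<close> patterns from \<open>W\<close> are followed by points of \<open>X\<close>. Each pattern can be read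
  off from the symbols in its own period, because patterns with a common word are equal; so there
  are \<open>card W ^ (k + 1)\<close> different words of length \<open>(k + 1) * P\<close>.
\<close>

lemma free_energy_of_patterns:
  fixes X :: "(int \<Rightarrow> 'a::{finite,discrete_topology}) set" and pat :: "'c::linorder \<Rightarrow> _"
  assumes X: "subshift X" and \<phi>: "continuous_on X \<phi>" "holder_on X \<phi>" and f: "glues X f"
    and B: "\<And>x. x \<in> X \<Longrightarrow> \<bar>\<phi> x\<bar> \<le> B"
    and K: "\<And>x y n. x \<in> X \<Longrightarrow> y \<in> X \<Longrightarrow> (\<And>i. i < n \<Longrightarrow> x (int i) = y (int i)) \<Longrightarrow>
       \<bar>birkhoff_sum \<phi> n x - birkhoff_sum \<phi> n y\<bar> \<le> K"
    and W: "finite W" "W \<noteq> {}" and P: "0 < P"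
    and pat: "\<And>a. a \<in> W \<Longrightarrow> pat a \<noteq> []"
      "\<And>a x n. a \<in> W \<Longrightarrow> (x, n) \<in> set (pat a) \<Longrightarrow> x \<in> X \<and> 0 < n \<and> f n \<le> g"
      "\<And>a. a \<in> W \<Longrightarrow> pattern_length g (pat a) = P"
      "\<And>a. a \<in> W \<Longrightarrow> v \<le> pattern_value \<phi> (K + real g * B) (pat a)"
    and separated: "\<And>a b z z'. a \<in> W \<Longrightarrow> b \<in> W \<Longrightarrow> a < b \<Longrightarrow>
      follows g z (pat a) \<Longrightarrow> follows g z' (pat b) \<Longrightarrow>
      (\<And>i. i < P \<Longrightarrow> z (int i) = z' (int i)) \<Longrightarrow> False"
  obtains \<nu> where "\<nu> \<in> invariant_measures X"
    "ereal ((ln (real (card W)) + v) / real P) \<le> free_energy \<phi> \<nu>"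
proof -
  have distinct: "a = b"
    if "a \<in> W" "b \<in> W" "follows g z (pat a)" "follows g z' (pat b)"
      "\<And>i. i < P \<Longrightarrow> z (int i) = z' (int i)" for a b z z'
    using separated[OF that(1,2) _ that(3,4,5)] separated[OF that(2,1) _ that(4,3) that(5)[symmetric]]
    by (metis linorder_neqE)
  define CS where "CS k = {cs. set cs \<subseteq> W \<and> length cs = Suc k}" for k
  have CS: "finite (CS k)" "card (CS k) = card W ^ Suc k" for k
    unfolding CS_def using W(1) by (rule finite_lists_length_eq, rule card_lists_length_eq)
  have "\<exists>z. z \<in> X \<and> follows g z (concat (map pat cs))" if cs: "cs \<in> CS k" for cs k
  proof -
    obtain a cs' where "cs = a # cs'" "a \<in> W"
      using cs by (cases cs) (auto simp: CS_def)
    then have "concat (map pat cs) \<noteq> []" using pat(1) by simp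
    moreover have "x \<in> X \<and> 0 < n \<and> f n \<le> g" if "(x, n) \<in> set (concat (map pat cs))" for x n
      using that cs pat(2) by (auto simp: CS_def)
    ultimately show ?thesis by (rule glues_follows[OF f]) blast+
  qed
  then obtain zz where zz: "\<And>k cs. cs \<in> CS k \<Longrightarrow> zz cs \<in> X \<and> follows g (zz cs) (concat (map pat cs))"
    by metis
  define E where "E k = zz ` CS k" for k
  define n where "n k = Suc k * P" for k
  have CS_W: "a \<in> W" if "cs \<in> CS k" "a \<in> set cs" for a cs k
    using that by (auto simp: CS_def)
  have inj: "cs = cs'" if cs: "cs \<in> CS k" "cs' \<in> CS k" and eq: "word (n k) (zz cs) = word (n k) (zz cs')"
    for k cs cs'
  proof (rule nth_equalityI)
    have len: "length cs = Suc k" "length cs' = Suc k" using cs by (auto simp: CS_def)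
    show "length cs = length cs'" using len by simp
    fix i assume i: "i < length cs"
    have eq': "zz cs (int j) = zz cs' (int j)" if "j < n k" for j
      using arg_cong[OF eq, of "\<lambda>w. w ! j"] that by (simp add: word_def)
    show "cs ! i = cs' ! i"
    proof (rule distinct)
      show "cs ! i \<in> W" "cs' ! i \<in> W" using cs i len CS_W nth_mem by metis+
      show "follows g ((shift ^^ (i * P)) (zz cs)) (pat (cs ! i))"
        by (rule follows_concat) (use pat(3) CS_W cs(1) zz i in auto)
      show "follows g ((shift ^^ (i * P)) (zz cs')) (pat (cs' ! i))"
        by (rule follows_concat) (use pat(3) CS_W cs(2) zz i len in auto)
      fix j assume "j < P"
      moreover have "i * P + P \<le> n k"
        using i len mult_le_mono1[of "Suc i" "Suc k" P] by (simp add: n_def)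
      ultimately have "j + i * P < n k" by linarith
      from eq'[OF this]
      show "(shift ^^ (i * P)) (zz cs) (int j) = (shift ^^ (i * P)) (zz cs') (int j)"
        by (simp add: funpow_shift_apply)
    qed
  qed
  have card_E: "card (E k) = card W ^ Suc k" for k
  proof -
    have "inj_on zz (CS k)" by (rule inj_onI) (rule inj, simp_all)
    then show ?thesis by (simp only: E_def card_image CS)
  qed
  have card_W: "0 < card W" using W by (simp add: card_gt_0_iff)
  have n_pos: "0 < n k" for k using P by (simp add: n_def)
  show ?thesis
  proof (rule variational_lower_bound[OF X \<phi>(1), of E n])
    show "finite (E k)" for k by (simp add: E_def CS)
    show E_ne: "E k \<noteq> {}" for k
      using card_E[of k] card_W by (metis card.empty less_numeral_extra(3) zero_less_power)
    show E_X: "E k \<subseteq> X" for k using zz by (auto simp: E_def)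
    show "inj_on (word (n k)) (E k)" for k
      unfolding E_def by (rule inj_onI) (auto dest: inj)
    have "n = (\<lambda>k. k * P + P)" by (auto simp: n_def)
    then show "filterlim n at_top sequentially"
      using P by (intro filterlim_at_top_mono[OF filterlim_ident]) (auto intro!: always_eventually trans_le_add1)
    show "\<exists>N. \<forall>x\<in>X. \<forall>y\<in>X. agree N x y \<longrightarrow> \<bar>\<phi> x - \<phi> y\<bar> \<le> e" if "0 < e" for e
      by (rule holder_uniform[OF \<phi>(2) that])
    show "ln (real (card W)) / real P \<le> ln (real (card (E k))) / real (n k)" for k
    proof -
      have "ln (real (card (E k))) = real (Suc k) * ln (real (card W))"
        unfolding card_E of_nat_power by (rule ln_realpow)
      then show ?thesis using P by (simp add: n_def del: of_nat_Suc mult_Suc)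
    qed
    show "v / real P \<le> orbit_average (E k) (n k) \<phi>" for k
    proof -
      have "real (Suc k) * v \<le> birkhoff_sum \<phi> (n k) z" if "z \<in> E k" for z
      proof -
        obtain cs where cs: "cs \<in> CS k" "z = zz cs" using \<open>z \<in> E k\<close> by (auto simp: E_def)
        have len: "length cs = Suc k" using cs by (simp add: CS_def)
        have "real (length cs) * v \<le> pattern_value \<phi> (K + real g * B) (concat (map pat cs))"
          by (rule pattern_value_concat) (use CS_W cs pat in auto)
        also have "\<dots> \<le> birkhoff_sum \<phi> (pattern_length g (concat (map pat cs))) z"
        proof (rule birkhoff_sum_follows[OF X B K])
          show "z \<in> X" "follows g z (concat (map pat cs))" using zz[OF cs(1)] cs(2) by auto
          fix x m assume "(x, m) \<in> set (concat (map pat cs))"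
          then obtain a where "a \<in> set cs" "(x, m) \<in> set (pat a)" by auto
          then show "x \<in> X" using CS_W[OF cs(1)] pat(2) by blast
        qed
        also have "pattern_length g (concat (map pat cs)) = n k"
          unfolding n_def len[symmetric] by (rule pattern_length_concat) (use CS_W cs pat in auto)
        finally show ?thesis by (simp add: len)
      qed
      then have "(\<Sum>z\<in>E k. real (Suc k) * v) \<le> (\<Sum>z\<in>E k. birkhoff_sum \<phi> (n k) z)"
        by (rule sum_mono)
      then have "real (card (E k)) * (real (Suc k) * v) \<le> (\<Sum>z\<in>E k. birkhoff_sum \<phi> (n k) z)"
        by simp
      then have "real (card (E k)) * (real (Suc k) * v) / (real (n k) * real (card (E k)))
          \<le> orbit_average (E k) (n k) \<phi>"
        unfolding orbit_average_def birkhoff_sum_def by (rule divide_right_mono) simp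
      also have "real (card (E k)) * (real (Suc k) * v) / (real (n k) * real (card (E k))) = v / real P"
        using P card_W by (simp add: n_def card_E del: of_nat_Suc mult_Suc)
      finally show ?thesis .
    qed
    fix \<nu> assume "\<nu> \<in> invariant_measures X"
      "ereal (ln (real (card W)) / real P + v / real P) \<le> free_energy \<phi> \<nu>"
    then show thesis using that by (simp add: add_divide_distrib)
  qed
qed

section \<open>Hyperbolicity\<close>

lemma exists_other_letter:
  assumes "subshift X" "X \<noteq> {}" "\<nexists>p. X = {p}"
  obtains y where "y \<in> X" "y 0 \<noteq> c"
proof -
  have "\<exists>y\<in>X. y 0 \<noteq> c"
  proof (rule ccontr)
    assume "\<not> ?thesis"
    then have "shift_pow i x 0 = c" if "x \<in> X" for x i
      using shift_pow_in[OF assms(1) that, of i] by blast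
    then have "x = (\<lambda>_. c)" if "x \<in> X" for x
      using that by (auto simp: shift_pow_def fun_eq_iff)
    then show False using assms(2,3) by blast
  qed
  then show ?thesis using that by blast
qed

text \<open>
  The orbit segment of \<open>x\<close> of length \<open>M\<close> is cut at one of \<open>R\<close> places and glued together with gaps \<open>g\<close>. A
  cut loses only a multiple of \<open>g + 1\<close> of the Birkhoff sum, and the choice of the place gains
  \<open>ln R\<close>, provided that the place can be recovered from the glued word.
  
  If \<open>x\<close> is not constant between consecutive places, the second piece is glued back delayed by one
  symbol. If two cuts at \<open>i < j\<close> lead to the same word, then between the cuts this word equals \<open>x\<close> because
  of \<open>j\<close> and the delayed \<open>x\<close> because of \<open>i\<close>, so \<open>x\<close> is constant there, a contradiction.
  
  Otherwise \<open>x\<close> repeats a symbol \<open>c\<close> on a long stretch. All cuts are then made within this stretch,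
  and each is marked by a symbol different from \<open>c\<close>, placed between two gaps.
\<close>

lemma free_energy_of_long_orbit:
  fixes X :: "(int \<Rightarrow> 'a::{finite,discrete_topology}) set"
  assumes X: "subshift X" and \<phi>: "continuous_on X \<phi>" "holder_on X \<phi>" and f: "glues X f" "mono f"
    and B: "\<And>x. x \<in> X \<Longrightarrow> \<bar>\<phi> x\<bar> \<le> B"
    and K: "0 \<le> K" "\<And>x y n. x \<in> X \<Longrightarrow> y \<in> X \<Longrightarrow> (\<And>i. i < n \<Longrightarrow> x (int i) = y (int i)) \<Longrightarrow>
       \<bar>birkhoff_sum \<phi> n x - birkhoff_sum \<phi> n y\<bar> \<le> K"
    and x: "x \<in> X" and letter: "\<And>c. \<exists>y\<in>X. y 0 \<noteq> c"
    and g: "f M \<le> g" "1 \<le> g" and R: "1 \<le> R" and M: "R * (R * (g + 1) + g) + 2 * g + 3 \<le> M"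
  obtains \<nu> P where "\<nu> \<in> invariant_measures X" "M \<le> P" "P \<le> M + 1 + g"
    "ereal ((ln (real R) + birkhoff_sum \<phi> M x - 3 * K - 7 * real g * B) / real P) \<le> free_energy \<phi> \<nu>"
proof -
  \<comment> \<open>a constant stretch of this length has room for \<open>R\<close> marked cuts at distance \<open>g + 1\<close>\<close>
  define D where "D = R * (g + 1) + g"
  \<comment> \<open>starting at \<open>1\<close> keeps the first piece nonempty\<close>
  define a where "a i = 1 + i * D" for i
  have a_le: "a i + 2 * g + 2 \<le> M" if "i \<le> R" for i
  proof -
    have "i * D \<le> R * D" using that by (rule mult_le_mono1)
    moreover have "R * D + 2 * g + 3 \<le> M" using M unfolding D_def .
    ultimately show ?thesis unfolding a_def by linarith
  qed
  have a_Suc: "a (Suc i) = a i + D" for i by (simp add: a_def)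
  have a_mono: "a i \<le> a j" if "i \<le> j" for i j using that by (simp add: a_def)
  have "0 \<le> B" using B[OF x] by linarith
  have f_le: "f n \<le> g" if "n \<le> M" for n using monoD[OF f(2) that] g(1) by linarith
  have bs: "\<bar>birkhoff_sum \<phi> n ((shift ^^ m) x)\<bar> \<le> real n * B" for n m
    by (rule birkhoff_sum_abs_le[OF X B funpow_shift_in[OF X x]])
  show ?thesis
  proof (cases "\<forall>i<R. \<exists>l. a i + g \<le> l \<and> l < a (Suc i) \<and> x (int l - 1) \<noteq> x (int l)")
    case True
    \<comment> \<open>the delay by one symbol: position \<open>a i + g\<close> of the pattern shows symbol \<open>a i + g - 1\<close> of \<open>x\<close>\<close>
    define pat where "pat i = [(x, a i), ((shift ^^ (a i + g - 1)) x, M + 1 - a i - g)]" for i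
    define v where "v = birkhoff_sum \<phi> M x - 2 * K - 3 * real g * B"
    obtain \<nu> where \<nu>: "\<nu> \<in> invariant_measures X"
      "ereal ((ln (real (card {..<R})) + v) / real (M + 1 + g)) \<le> free_energy \<phi> \<nu>"
    proof (rule free_energy_of_patterns[OF X \<phi> f(1) B K(2),
          where W = "{..<R}" and P = "M + 1 + g" and pat = pat and g = g and v = v])
      show "finite {..<R}" "{..<R} \<noteq> {}" "0 < M + 1 + g" "\<And>i. pat i \<noteq> []"
        using R by (auto simp: pat_def lessThan_empty_iff)
      fix i assume "i \<in> {..<R}"
      then have i: "a i + 2 * g + 2 \<le> M" by (intro a_le) simp
      show "pattern_length g (pat i) = M + 1 + g"
        using i by (simp add: pat_def)
      show "y \<in> X \<and> 0 < n \<and> f n \<le> g" if "(y, n) \<in> set (pat i)" for y n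
      proof -
        have "y \<in> X" using that x funpow_shift_in[OF X x] by (auto simp: pat_def)
        moreover have "0 < n \<and> n \<le> M" using that i g(2) by (auto simp: pat_def a_def)
        ultimately show ?thesis using f_le by blast
      qed
      show "v \<le> pattern_value \<phi> (K + real g * B) (pat i)"
      proof -
        define s where "s = M + 1 - a i - g"
        have s: "M = a i + (g - 1) + s" using i g(2) by (simp add: s_def)
        have "birkhoff_sum \<phi> M x = birkhoff_sum \<phi> (a i) x
            + birkhoff_sum \<phi> (g - 1) ((shift ^^ a i) x)
            + birkhoff_sum \<phi> s ((shift ^^ (a i + g - 1)) x)"
          unfolding s birkhoff_sum_add using g(2) by simp
        moreover have "birkhoff_sum \<phi> (g - 1) ((shift ^^ a i) x) \<le> real g * B"
        proof -
          have "birkhoff_sum \<phi> (g - 1) ((shift ^^ a i) x) \<le> real (g - 1) * B"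
            using bs[of "g - 1" "a i"] by linarith
          also have "\<dots> \<le> real g * B" using \<open>0 \<le> B\<close> by (intro mult_right_mono) auto
          finally show ?thesis .
        qed
        moreover have "pattern_value \<phi> (K + real g * B) (pat i) = birkhoff_sum \<phi> (a i) x
            + birkhoff_sum \<phi> s ((shift ^^ (a i + g - 1)) x) - 2 * (K + real g * B)"
          unfolding pat_def s_def[symmetric] by simp
        ultimately show ?thesis by (simp add: v_def algebra_simps)
      qed
    next
      fix i j z z'
      assume "j \<in> {..<R}" and "i < j" and z: "follows g z (pat i)" "follows g z' (pat j)"
        and eq: "\<And>l. l < M + 1 + g \<Longrightarrow> z (int l) = z' (int l)"
      then have ij: "i < j" "j < R" by auto
      show False
      proof -
        obtain l where l: "a i + g \<le> l" "l < a (Suc i)" "x (int l - 1) \<noteq> x (int l)"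
          using True ij by (metis order.strict_trans)
        have lj: "l < a j" using l(2) a_mono[of "Suc i" j] ij by simp
        have lM: "l + 2 \<le> M" using lj a_le[of j] ij by simp
        have "z' (int l) = x (int l)" using z(2) lj by (simp add: pat_def)
        moreover have "z (int l) = x (int l - 1)"
        proof -
          define j' where "j' = l - (a i + g)"
          have j': "j' < M + 1 - a i - g" "l = j' + (a i + g)" using lM l(1) by (auto simp: j'_def)
          then have "(shift ^^ (a i + g)) z (int j') = (shift ^^ (a i + g - 1)) x (int j')"
            using z(1) by (simp add: pat_def)
          then show ?thesis
            using g(2) j'(2) by (simp add: funpow_shift_apply of_nat_diff algebra_simps)
        qed
        moreover have "z (int l) = z' (int l)" using lM by (intro eq) simp
        ultimately show False using l(3) by simp
      qed
    qed blast
    have "(ln (real R) + birkhoff_sum \<phi> M x - 3 * K - 7 * real g * B) / real (M + 1 + g)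
        \<le> (ln (real (card {..<R})) + v) / real (M + 1 + g)"
      using K(1) \<open>0 \<le> B\<close> by (intro divide_right_mono) (auto simp: v_def)
    then have "ereal ((ln (real R) + birkhoff_sum \<phi> M x - 3 * K - 7 * real g * B) / real (M + 1 + g))
        \<le> free_energy \<phi> \<nu>"
      using \<nu>(2) by (meson ereal_less_eq(3) order.trans)
    then show ?thesis by (intro that[OF \<nu>(1), of "M + 1 + g"]) auto
  next
    case False
    then obtain i where i: "i < R"
      and const: "\<And>l. a i + g \<le> l \<Longrightarrow> l < a (Suc i) \<Longrightarrow> x (int l - 1) = x (int l)" by blast
    define s where "s = a i + g - 1"
    define c where "c = x (int s)"
    have c: "x (int l) = c" if "s \<le> l" "l < a (Suc i)" for l
      using that
    proof (induction l rule: dec_induct)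
      case (step l)
      then show ?case using const[of "Suc l"] g(2) by (simp add: s_def)
    qed (simp add: c_def)
    obtain y where y: "y \<in> X" "y 0 \<noteq> c" using letter by blast
    define b where "b r = s + r * (g + 1)" for r
    have b_less: "b r < a (Suc i)" if "r < R" for r
      using mult_le_mono1[of r R "g + 1"] that g(2) by (simp add: b_def s_def a_Suc D_def)
    have b_M: "b r + 2 * g + 2 \<le> M" if "r < R" for r
      using b_less[OF that] a_le[of "Suc i"] i by simp
    \<comment> \<open>no delay: the marker and its two gaps replace \<open>2 * g + 1\<close> symbols of \<open>x\<close>\<close>
    define pat where "pat r = [(x, b r), (y, 1), ((shift ^^ (b r + 2 * g + 1)) x, M - b r - 2 * g - 1)]" for r
    define v where "v = birkhoff_sum \<phi> M x - 3 * K - 7 * real g * B"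
    obtain \<nu> where \<nu>: "\<nu> \<in> invariant_measures X"
      "ereal ((ln (real (card {..<R})) + v) / real (M + g)) \<le> free_energy \<phi> \<nu>"
    proof (rule free_energy_of_patterns[OF X \<phi> f(1) B K(2),
          where W = "{..<R}" and P = "M + g" and pat = pat and g = g and v = v])
      show "finite {..<R}" "{..<R} \<noteq> {}" "0 < M + g" "\<And>i. pat i \<noteq> []"
        using R g(2) by (auto simp: pat_def lessThan_empty_iff)
      fix r assume "r \<in> {..<R}"
      then have r: "b r + 2 * g + 2 \<le> M" by (intro b_M) simp
      show "pattern_length g (pat r) = M + g"
        using r by (simp add: pat_def)
      show "u \<in> X \<and> 0 < n \<and> f n \<le> g" if "(u, n) \<in> set (pat r)" for u n
      proof -
        have "u \<in> X"
          using that x y(1) funpow_shift_in[OF X x] by (auto simp: pat_def simp del: funpow.simps)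
        moreover have "0 < n \<and> n \<le> M" using that r g(2) by (auto simp: pat_def b_def s_def a_def)
        ultimately show ?thesis using f_le by blast
      qed
      show "v \<le> pattern_value \<phi> (K + real g * B) (pat r)"
      proof -
        define t where "t = M - b r - 2 * g - 1"
        have t: "M = b r + (2 * g + 1) + t" using r by (simp add: t_def)
        have "birkhoff_sum \<phi> M x = birkhoff_sum \<phi> (b r) x
            + birkhoff_sum \<phi> (2 * g + 1) ((shift ^^ b r) x)
            + birkhoff_sum \<phi> t ((shift ^^ (b r + 2 * g + 1)) x)"
          unfolding t birkhoff_sum_add by (simp only: add.assoc)
        moreover have "birkhoff_sum \<phi> (2 * g + 1) ((shift ^^ b r) x) \<le> (2 * real g + 1) * B"
          using bs[of "2 * g + 1" "b r"] by (simp add: algebra_simps)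
        moreover have "- B \<le> birkhoff_sum \<phi> 1 y"
          using B[OF y(1)] by (simp add: birkhoff_sum_def abs_le_iff)
        moreover have "2 * B \<le> 2 * (real g * B)"
          using \<open>0 \<le> B\<close> g(2) mult_right_mono[of 1 "real g" B] by simp
        moreover have "pattern_value \<phi> (K + real g * B) (pat r) = birkhoff_sum \<phi> (b r) x
            + birkhoff_sum \<phi> 1 y + birkhoff_sum \<phi> t ((shift ^^ (b r + 2 * g + 1)) x)
            - 3 * (K + real g * B)"
          unfolding pat_def t_def[symmetric] by (simp del: funpow.simps)
        ultimately show ?thesis by (simp add: v_def algebra_simps del: funpow.simps)
      qed
    next
      fix r r' z z'
      assume "r' \<in> {..<R}" and "r < r'" and z: "follows g z (pat r)" "follows g z' (pat r')"
        and eq: "\<And>l. l < M + g \<Longrightarrow> z (int l) = z' (int l)"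
      then have rr: "r < r'" "r' < R" by auto
      show False
      proof -
        have less: "b r + g < b r'"
          using mult_le_mono1[of "Suc r" r' "g + 1"] rr by (simp add: b_def)
        have "z (int (b r + g)) = y 0"
          using z(1) by (simp add: pat_def funpow_shift_apply)
        moreover have "z' (int (b r + g)) = x (int (b r + g))"
          using z(2) less unfolding pat_def follows.simps by blast
        moreover have "x (int (b r + g)) = c"
          using less b_less[OF rr(2)] by (intro c) (auto simp: b_def)
        moreover have "z (int (b r + g)) = z' (int (b r + g))"
          using b_M[OF rr(2)] less by (intro eq) simp
        ultimately show False using y(2) by simp
      qed
    qed blast
    have "ereal ((ln (real R) + birkhoff_sum \<phi> M x - 3 * K - 7 * real g * B) / real (M + g))
        \<le> free_energy \<phi> \<nu>"
      using \<nu>(2) by (simp add: v_def algebra_simps)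
    then show ?thesis by (intro that[OF \<nu>(1), of "M + g"]) auto
  qed
qed

text \<open>
  With about \<open>M powr (1/4)\<close> places the gain is close to \<open>1/4 * ln M\<close>. The constant \<open>100 * (B + 1)\<close> keeps the
  cost below \<open>9/100 * ln M\<close> up to a constant, and the fourth root leaves room for the square of the
  number of places times the gap within the length \<open>M\<close>.
\<close>

lemma eventually_gain_exceeds_cost:
  fixes B K :: real
  assumes "0 \<le> B"
  shows "eventually (\<lambda>M::nat. 3 * K + 9 * B * (ln (real M) / (100 * (B + 1)) + 1)
      < ln (M powr (1/4) - 1)) at_top"
proof -
  have "eventually (\<lambda>M::nat. (3 * K + 9 * B) + 9/100 * ln (real M) < ln (M powr (1/4) - 1)) at_top"
    by real_asymp
  then show ?thesis
    using eventually_ge_at_top[of 1]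
  proof eventually_elim
    case (elim M)
    have "B / (B + 1) * ln (real M) \<le> 1 * ln (real M)"
      using assms elim(2) by (intro mult_right_mono) auto
    moreover have eq: "9 * B * (ln (real M) / (100 * (B + 1)) + 1)
        = 9/100 * (B / (B + 1) * ln (real M)) + 9 * B"
      using assms by (simp add: divide_simps) (simp add: algebra_simps)
    ultimately show ?case unfolding eq using elim(1) by linarith
  qed
qed

lemma eventually_room_for_breaks:
  "eventually (\<lambda>M::nat. M powr (1/4) * (M powr (1/4) * (ln M + 2) + (ln M + 1)) + 2 * (ln M + 1) + 3
     \<le> real M) at_top"
  by real_asymp

text \<open>
  If an equilibrium state has entropy zero, then its integral \<open>\<beta>\<close> bounds all free energies. For every
  \<open>M\<close> some orbit segment of length \<open>M\<close> has Birkhoff sum at least \<open>M * \<beta>\<close>. For the arbitrarily large \<open>M\<close>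
  at which \<open>f M / ln M\<close> is small, cutting this segment gains more entropy than it loses in the
  integral, which contradicts the bound.
\<close>

theorem spec_class_hyperbolic:
  fixes X :: "(int \<Rightarrow> 'a::{finite,discrete_topology}) set"
  assumes "X \<in> spec_class" "\<nexists>p. X = {p}" "continuous_on X \<phi>" "holder_on X \<phi>"
  shows "hyperbolic X \<phi>"
  unfolding hyperbolic_def
proof (intro allI impI, rule ccontr)
  fix \<mu> assume eq: "equilibrium_state X \<phi> \<mu>" and "\<not> 0 < ks_entropy \<mu> shift"
  then have zero: "ks_entropy \<mu> shift \<le> 0" by simp
  from assms(1) obtain f where X: "subshift X" and f: "mono f" "glues X f"
    "liminf (\<lambda>n. ereal (real (f n) / ln (real n))) = 0"
    unfolding spec_class_iff_glues by blast
  have \<mu>: "\<mu> \<in> invariant_measures X" using eq by (simp add: equilibrium_state_def)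
  interpret prob_space \<mu> using \<mu> by (simp add: invariant_measures_def)
  have sets: "sets \<mu> = sets (restrict_space borel X)" using \<mu> by (simp add: invariant_measures_def)
  have "X \<noteq> {}" using not_empty space_subshift_measure[OF sets] by simp
  define \<beta> where "\<beta> = integral\<^sup>L \<mu> \<phi>"
  have max: "free_energy \<phi> \<nu> \<le> ereal \<beta>" if "\<nu> \<in> invariant_measures X" for \<nu>
  proof -
    have "free_energy \<phi> \<nu> \<le> free_energy \<phi> \<mu>"
      using eq that unfolding equilibrium_state_def by (simp add: SUP_upper)
    also have "\<dots> \<le> 0 + ereal \<beta>"
      unfolding free_energy_def \<beta>_def by (rule add_right_mono[OF zero])
    finally show ?thesis by simp
  qed
  obtain K where K: "0 \<le> K"
    "\<And>x y n. x \<in> X \<Longrightarrow> y \<in> X \<Longrightarrow> (\<And>i. i < n \<Longrightarrow> x (int i) = y (int i)) \<Longrightarrow>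
       \<bar>birkhoff_sum \<phi> n x - birkhoff_sum \<phi> n y\<bar> \<le> K"
    by (rule holder_distortion[OF X assms(4)]) blast
  obtain B' where "\<And>x. x \<in> X \<Longrightarrow> \<bar>\<phi> x\<bar> \<le> B'"
    using potential_bounded[OF X assms(3)] by metis
  then obtain B where B: "\<And>x. x \<in> X \<Longrightarrow> \<bar>\<phi> x\<bar> \<le> B" "\<bar>\<beta>\<bar> \<le> B"
    using max.cobounded2[of "\<bar>\<beta>\<bar>" B'] by (metis max.coboundedI1 max.cobounded2)
  have "0 \<le> B" using B(2) by linarith
  define \<epsilon> where "\<epsilon> = 1 / (100 * (B + 1))"
  have \<epsilon>: "0 < \<epsilon>" "\<epsilon> \<le> 1" using \<open>0 \<le> B\<close> by (auto simp: \<epsilon>_def divide_simps)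
  have "\<not> eventually (\<lambda>n. ereal \<epsilon> \<le> ereal (real (f n) / ln (real n))) sequentially"
  proof
    assume "eventually (\<lambda>n. ereal \<epsilon> \<le> ereal (real (f n) / ln (real n))) sequentially"
    then have "ereal \<epsilon> \<le> liminf (\<lambda>n. ereal (real (f n) / ln (real n)))" by (rule Liminf_bounded)
    then show False using f(3) \<epsilon>(1) by simp
  qed
  then have "frequently (\<lambda>n. real (f n) / ln (real n) < \<epsilon>) sequentially"
    by (simp add: not_eventually not_le)
  moreover have "eventually (\<lambda>M. 3 * K + 9 * B * (ln (real M) / (100 * (B + 1)) + 1) < ln (M powr (1/4) - 1) \<and>
     M powr (1/4) * (M powr (1/4) * (ln M + 2) + (ln M + 1)) + 2 * (ln M + 1) + 3 \<le> real M \<and> M > 16) sequentially"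
    using eventually_gain_exceeds_cost[OF \<open>0 \<le> B\<close>, of K] eventually_room_for_breaks
      eventually_gt_at_top[of "16::nat"] by eventually_elim simp
  ultimately obtain M where M: "real (f M) / ln (real M) < \<epsilon>" "16 < M"
    "3 * K + 9 * B * (ln (real M) / (100 * (B + 1)) + 1) < ln (M powr (1/4) - 1)"
    "M powr (1/4) * (M powr (1/4) * (ln M + 2) + (ln M + 1)) + 2 * (ln M + 1) + 3 \<le> real M"
    using frequently_eventually_frequently[THEN frequently_ex] by blast
  \<comment> \<open>a positive gap, as the delay by one symbol requires\<close>
  define g where "g = f M + 1"
  have lnM: "0 < ln (real M)" using M(2) by simp
  have g: "real g \<le> \<epsilon> * ln (real M) + 1" using M(1) lnM by (simp add: g_def field_simps)
  also have "\<dots> \<le> ln (real M) + 1" using \<epsilon> lnM by simp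
  finally have g': "real g \<le> ln (real M) + 1" .
  define R where "R = nat \<lfloor>M powr (1/4)\<rfloor>"
  \<comment> \<open>so rounding down to \<open>R\<close> keeps \<open>R\<close> and the argument of the logarithm positive\<close>
  have "2 = (16::real) powr (1/4)"
    using powr_powr[of 2 4 "1/4"] by simp
  also have "\<dots> \<le> real M powr (1/4)" using M(2) by (intro powr_mono2) auto
  finally have two: "2 \<le> real M powr (1/4)" .
  have R: "real R \<le> M powr (1/4)" "M powr (1/4) - 1 < real R" "1 \<le> R"
    unfolding R_def using two by linarith+
  obtain x where x: "x \<in> X" "real M * \<beta> \<le> birkhoff_sum \<phi> M x"
    unfolding \<beta>_def by (rule exists_birkhoff_sum_ge[OF X assms(3) \<mu>])
  obtain \<nu> P where \<nu>: "\<nu> \<in> invariant_measures X" and P: "M \<le> P" "P \<le> M + 1 + g"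
    and F: "ereal ((ln (real R) + birkhoff_sum \<phi> M x - 3 * K - 7 * real g * B) / real P) \<le> free_energy \<phi> \<nu>"
  proof (rule free_energy_of_long_orbit[OF X assms(3,4) f(2,1) B(1) K x(1), of M g R])
    show "\<exists>y\<in>X. y 0 \<noteq> c" for c by (rule exists_other_letter[OF X \<open>X \<noteq> {}\<close> assms(2), of c]) blast
    show "f M \<le> g" "1 \<le> g" by (auto simp: g_def)
    show "1 \<le> R" by (rule R(3))
    have "real R * (real R * (real g + 1) + real g) + 2 * real g + 3
        \<le> M powr (1/4) * (M powr (1/4) * (ln M + 2) + (ln M + 1)) + 2 * (ln M + 1) + 3"
    proof -
      let ?p = "real M powr (1/4)"
      have "real R * (real g + 1) \<le> ?p * (ln M + 2)"
        using R(1) g' lnM by (intro mult_mono) auto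
      then have "real R * (real g + 1) + real g \<le> ?p * (ln M + 2) + (ln M + 1)"
        using g' by linarith
      then have "real R * (real R * (real g + 1) + real g) \<le> ?p * (?p * (ln M + 2) + (ln M + 1))"
        using R(1) by (intro mult_mono) auto
      then show ?thesis using g' by (intro add_mono order_refl) simp_all
    qed
    also have "\<dots> \<le> real M" by (rule M(4))
    finally have "real (R * (R * (g + 1) + g) + 2 * g + 3) \<le> real M" by (simp add: algebra_simps)
    then show "R * (R * (g + 1) + g) + 2 * g + 3 \<le> M" by (simp only: of_nat_le_iff)
  qed blast
  have "(ln (real R) + birkhoff_sum \<phi> M x - 3 * K - 7 * real g * B) / real P \<le> \<beta>"
    using order.trans[OF F max[OF \<nu>]] by simp
  then have "ln (real R) + birkhoff_sum \<phi> M x - 3 * K - 7 * real g * B \<le> real P * \<beta>"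
    using P(1) M(2) by (simp add: field_simps)
  then have "ln (real R) \<le> 3 * K + 7 * real g * B + (real P - real M) * \<beta>"
    using x(2) by (simp add: algebra_simps)
  also have "(real P - real M) * \<beta> \<le> (2 * real g) * B"
  proof -
    have "(real P - real M) * \<beta> \<le> (real P - real M) * B"
      using P(1) B(2) by (intro mult_left_mono) auto
    also have "\<dots> \<le> (2 * real g) * B"
      using P(2) \<open>0 \<le> B\<close> by (intro mult_right_mono) (auto simp: g_def)
    finally show ?thesis .
  qed
  finally have "ln (real R) \<le> 3 * K + 9 * B * real g" by (simp add: algebra_simps)
  also have "\<dots> \<le> 3 * K + 9 * B * (ln (real M) / (100 * (B + 1)) + 1)"
    using g \<open>0 \<le> B\<close> by (intro add_left_mono mult_left_mono) (auto simp: \<epsilon>_def)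
  also have "\<dots> < ln (M powr (1/4) - 1)" by (rule M(3))
  also have "\<dots> \<le> ln (real R)" using R two by (intro ln_mono) auto
  finally show False by simp
qed

theorem corollary1p8:
  shows "(\<forall>(X :: (int \<Rightarrow> 'a::{finite,discrete_topology}) set)
            (Y :: (int \<Rightarrow> 'b::{finite,discrete_topology}) set) \<pi>.
            X \<in> spec_class \<and> subshift Y \<and> subshift_factor_map X Y \<pi> \<longrightarrow> Y \<in> spec_class) \<and>
         (\<forall>(X :: (int \<Rightarrow> 'a) set) \<phi>.
            X \<in> spec_class \<and> (\<nexists>p. X = {p}) \<and> potential X \<phi> \<and> holder_on X \<phi> \<longrightarrow> hyperbolic X \<phi>)"
  using spec_class_factor spec_class_hyperbolic unfolding potential_def by blast

end
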